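(* Let $h>0$. For every $(q_0,p_0,\omega_0)\in H\times H\times\mathcal G^\star$ there exists a unique weak solution $(q(t),p(t),\omega(t))=(X(t),\omega(t))$ on $\mathbb R$ of the Hamiltonian system with $q(0)=q_0$, $p(0)=p_0$, $\omega(0)=\omega_0$. There is a constant $C$ (independent of the solution) such that, for all $t\in\mathbb R$, $$|\omega(t)|=|\omega(0)|,\qquad |X(t)|\le|X(0)|+C|t|\,|\omega(0)|.$$ If $q_0$ and $p_0$ belong to $D(M)$, then this solution is a strong solution.
   Context: $H$ is the real Hilbert space of $f=(f_1,f_2,f_3):\mathbb R^3\to\mathbb R^3$ with $f_j\in L^2(\mathbb R^3)$ real valued and $k\cdot f(k)=0$ a.e., with $|f|^2=\sum_j\int|f_j(k)|^2dk$ and scalar product $\cdot$. $M$ is multiplication by $|k|$ in $H$ with domain $D(M)$. $\chi\in\mathcal S(\mathbb R)$ is a fixed real-valued function vanishing near $0$; $(e_1,e_2,e_3)$ is the canonical basis of $\mathbb R^3$; $\wedge$ is the cross product. For $x\in\mathbb R^3$, $m=1,2,3$, $a_m(x),b_m(x)\in H$ are $$a_m(x)(k)=\frac{\chi(|k|)|k|^{1/2}}{(2\pi)^{3/2}}\sin(k\cdot x)\frac{k\wedge e_m}{|k|},\qquad b_m(x)(k)=\frac{\chi(|k|)|k|^{1/2}}{(2\pi)^{3/2}}\cos(k\cdot x)\frac{k\wedge e_m}{|k|},$$ and $B_m(x,q,p)=a_m(x)\cdot q+b_m(x)\cdot p$ for $(q,p)\in H^2$. Points $x_1,\dots,x_N\in\mathbb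 R^3$ and a vector $\beta=(\beta_1,\beta_2,\beta_3)\in\mathbb R^3$ are fixed. $\mathcal H_{sp}=(\mathbb C^2)^{\otimes N}$ and $\sigma_m^{[\lambda]}$ is the Pauli matrix $\sigma_m$ acting on the $\lambda$-th factor. $\mathcal G$ is the Lie algebra of $SU(2^N)=SU(\mathcal H_{sp})$ (traceless antihermitian maps) with scalar product $X\cdot Y=-\mathrm{Tr}(XY)$; its dual $\mathcal G^\star$ carries the associated Euclidean structure. The Hamiltonian system is $$q'=Mp+h\sum_{\lambda,m}b_m(x_\lambda)\langle\omega,i\sigma_m^{[\lambda]}\rangle,\qquad p'=-Mq-h\sum_{\lambda,m}a_m(x_\lambda)\langle\omega,i\sigma_m^{[\lambda]}\rangle,$$ $$\frac{d}{dt}\langle\omega,Y\rangle=\sum_{\lambda=1}^N\sum_{m=1}^3(\beta_m+B_m(x_\lambda,q,p))\langle\omega,[i\sigma_m^{[\lambda]},Y]\rangle\quad(Y\in\mathcal G).$$ With $R_t(q,p)=(q_t,p_t)$, $q_t(k)=\cos(t|k|)q(k)+\sin(t|k|)p(k)$, $p_t(k)=-\sin(t|k|)q(k)+\cos(t|k|)p(k)$, a weak solution is a continuous map $t\mapsto(q(t),p(t),\omega(t))=(X(t),\omega(t))$ from $\mathbb R$ to $H\times H\times\mathcal G^\star$ such that $X(t)=R_t(X(0))+\int_0^tR_{t-s}(Q(s),P(s))ds$, where $Q(s)=h\sum_{\lambda,m}b_m(x_\lambda)\langle\omega(s),i\sigma_m^{[\lambda]}\rangle$ and $P(s)=-h\sum_{\lambda,m}a_m(x_\lambda)\langle\omega(s),i\sigma_m^{[\lambda]}\rangle$,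 and such that for all $Y\in\mathcal G$, $\langle\omega(t),Y\rangle=\langle\omega(0),Y\rangle+\sum_{\lambda,m}\int_0^t(\beta_m+B_m(x_\lambda,q(s),p(s)))\langle\omega(s),[i\sigma_m^{[\lambda]},Y]\rangle ds$. A strong solution is a map continuous from $\mathbb R$ to $D(M)\times D(M)\times\mathcal G^\star$, $C^1$ from $\mathbb R$ to $H\times H\times\mathcal G^\star$, satisfying the three differential equations of the system. *)

theory Defs
  imports "HOL-Analysis.Analysis"
begin

definition transverse_L2 :: "(real^3 \<Rightarrow> real^3) \<Rightarrow> bool" where
  "transverse_L2 f \<longleftrightarrow> f \<in> borel_measurable lborel \<and>
     integrable lborel (\<lambda>k. (norm (f k))\<^sup>2) \<and> (AE k in lborel. k \<bullet> f k = 0)"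

definition hrel :: "(real^3 \<Rightarrow> real^3) \<Rightarrow> (real^3 \<Rightarrow> real^3) \<Rightarrow> bool" where
  "hrel f g \<longleftrightarrow> transverse_L2 f \<and> transverse_L2 g \<and> (AE k in lborel. f k = g k)"

lemma transverse_L2_measurable: "transverse_L2 f \<Longrightarrow> f \<in> borel_measurable borel"
  by (simp add: transverse_L2_def)

lemma transverse_L2_0 [simp]: "transverse_L2 (\<lambda>k. 0)"
  by (simp add: transverse_L2_def)

lemma transverse_L2_add:
  assumes "transverse_L2 f" "transverse_L2 g"
  shows "transverse_L2 (\<lambda>k. f k + g k)"
proof -
  have [measurable]: "f \<in> borel_measurable lborel" "g \<in> borel_measurable lborel"
    and ints: "integrable lborel (\<lambda>k. (norm (f k))\<^sup>2)" "integrable lborel (\<lambda>k. (norm (g k))\<^sup>2)"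
    using assms by (auto simp: transverse_L2_def)
  have "integrable lborel (\<lambda>k. 2 * (norm (f k))\<^sup>2 + 2 * (norm (g k))\<^sup>2)"
    using ints by simp
  then have "integrable lborel (\<lambda>k. (norm (f k + g k))\<^sup>2)"
  proof (rule Bochner_Integration.integrable_bound)
    show "AE k in lborel. norm ((norm (f k + g k))\<^sup>2) \<le> norm (2 * (norm (f k))\<^sup>2 + 2 * (norm (g k))\<^sup>2)"
    proof (intro AE_I2)
      fix k
      have "(norm (f k + g k))\<^sup>2 \<le> (norm (f k) + norm (g k))\<^sup>2"
        by (intro power_mono norm_triangle_ineq) simp
      also have "\<dots> \<le> 2 * (norm (f k))\<^sup>2 + 2 * (norm (g k))\<^sup>2"
        using sum_squares_bound[of "norm (f k)" "norm (g k)"] by (simp add: power2_sum)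
      finally show "norm ((norm (f k + g k))\<^sup>2) \<le> norm (2 * (norm (f k))\<^sup>2 + 2 * (norm (g k))\<^sup>2)"
        by simp
    qed
  qed measurable
  moreover have "AE k in lborel. k \<bullet> (f k + g k) = 0"
    using assms unfolding transverse_L2_def by (auto simp: inner_add_right)
  ultimately show ?thesis by (simp add: transverse_L2_def)
qed

lemma transverse_L2_mult:
  fixes \<phi> :: "real^3 \<Rightarrow> real"
  assumes "transverse_L2 f" and [measurable]: "\<phi> \<in> borel_measurable borel"
    and "integrable lborel (\<lambda>k. (norm (\<phi> k *\<^sub>R f k))\<^sup>2)"
  shows "transverse_L2 (\<lambda>k. \<phi> k *\<^sub>R f k)"
proof -
  have [measurable]: "f \<in> borel_measurable lborel"
    using assms by (auto simp: transverse_L2_def)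
  have "AE k in lborel. k \<bullet> (\<phi> k *\<^sub>R f k) = 0"
    using assms unfolding transverse_L2_def by auto
  then show ?thesis using assms(3) by (simp add: transverse_L2_def)
qed

lemma transverse_L2_mult_bounded:
  fixes \<phi> :: "real^3 \<Rightarrow> real"
  assumes "transverse_L2 f" and [measurable]: "\<phi> \<in> borel_measurable borel"
    and "\<And>k. \<bar>\<phi> k\<bar> \<le> B"
  shows "transverse_L2 (\<lambda>k. \<phi> k *\<^sub>R f k)"
proof -
  have [measurable]: "f \<in> borel_measurable lborel"
    and int: "integrable lborel (\<lambda>k. (norm (f k))\<^sup>2)"
    using assms by (auto simp: transverse_L2_def)
  have "integrable lborel (\<lambda>k. B\<^sup>2 * (norm (f k))\<^sup>2)" using int by simp
  then have "integrable lborel (\<lambda>k. (norm (\<phi> k *\<^sub>R f k))\<^sup>2)"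
  proof (rule Bochner_Integration.integrable_bound)
    show "AE k in lborel. norm ((norm (\<phi> k *\<^sub>R f k))\<^sup>2) \<le> norm (B\<^sup>2 * (norm (f k))\<^sup>2)"
      using power_mono[OF assms(3) abs_ge_zero, of _ 2]
      by (intro AE_I2) (simp add: power_mult_distrib mult_right_mono)
  qed measurable
  with assms show ?thesis by (intro transverse_L2_mult) auto
qed

lemma transverse_L2_scale: "transverse_L2 f \<Longrightarrow> transverse_L2 (\<lambda>k. c *\<^sub>R f k)"
  by (rule transverse_L2_mult_bounded[where B = "\<bar>c\<bar>"]) auto

lemma transverse_L2_minus: "transverse_L2 f \<Longrightarrow> transverse_L2 (\<lambda>k. - f k)"
  using transverse_L2_scale[of f "-1"] by simp

lemma transverse_L2_diff:
  "transverse_L2 f \<Longrightarrow> transverse_L2 g \<Longrightarrow> transverse_L2 (\<lambda>k. f k - g k)"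
  using transverse_L2_add[of f "\<lambda>k. - g k"] transverse_L2_minus[of g] by simp

lemma transverse_L2_inner:
  assumes "transverse_L2 f" "transverse_L2 g"
  shows "integrable lborel (\<lambda>k. f k \<bullet> g k)"
proof -
  have [measurable]: "f \<in> borel_measurable lborel" "g \<in> borel_measurable lborel"
    and ints: "integrable lborel (\<lambda>k. (norm (f k))\<^sup>2)" "integrable lborel (\<lambda>k. (norm (g k))\<^sup>2)"
    using assms by (auto simp: transverse_L2_def)
  have "integrable lborel (\<lambda>k. (norm (f k))\<^sup>2 + (norm (g k))\<^sup>2)"
    using ints by simp
  then show ?thesis
  proof (rule Bochner_Integration.integrable_bound)
    show "AE k in lborel. norm (f k \<bullet> g k) \<le> norm ((norm (f k))\<^sup>2 + (norm (g k))\<^sup>2)"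
    proof (intro AE_I2)
      fix k
      have "\<bar>f k \<bullet> g k\<bar> \<le> norm (f k) * norm (g k)"
        by (rule Cauchy_Schwarz_ineq2)
      also have "\<dots> \<le> (norm (f k))\<^sup>2 + (norm (g k))\<^sup>2"
        using sum_squares_bound[of "norm (f k)" "norm (g k)"]
          mult_nonneg_nonneg[OF norm_ge_zero norm_ge_zero, of "f k" "g k"] by linarith
      finally show "norm (f k \<bullet> g k) \<le> norm ((norm (f k))\<^sup>2 + (norm (g k))\<^sup>2)"
        by simp
    qed
  qed measurable
qed

text \<open>
  The Hilbert space \<open>H\<close>: square-integrable fields with \<open>k \<cdot> f(k) = 0\<close> a.e., modulo a.e. equality;
  completeness is the instance \<^class>\<open>complete_space\<close> below.
\<close>

quotient_type hfield = "real^3 \<Rightarrow> real^3" / partial: hrel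
proof (rule part_equivpI)
  show "\<exists>f. hrel f f" by (rule exI[of _ "\<lambda>k. 0"]) (simp add: hrel_def)
  show "symp hrel" by (auto simp: symp_def hrel_def elim: AE_mp)
  show "transp hrel"
    unfolding transp_def hrel_def by auto
qed

instantiation hfield :: real_inner
begin

lift_definition zero_hfield :: hfield is "\<lambda>k. 0"
  by (simp add: hrel_def)

lift_definition plus_hfield :: "hfield \<Rightarrow> hfield \<Rightarrow> hfield" is "\<lambda>f g k. f k + g k"
  unfolding hrel_def by (auto intro!: transverse_L2_add)

lift_definition minus_hfield :: "hfield \<Rightarrow> hfield \<Rightarrow> hfield" is "\<lambda>f g k. f k - g k"
  unfolding hrel_def by (auto intro!: transverse_L2_diff)

lift_definition uminus_hfield :: "hfield \<Rightarrow> hfield" is "\<lambda>f k. - f k"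
  unfolding hrel_def by (auto intro!: transverse_L2_minus)

lift_definition scaleR_hfield :: "real \<Rightarrow> hfield \<Rightarrow> hfield" is "\<lambda>c f k. c *\<^sub>R f k"
  unfolding hrel_def by (auto intro!: transverse_L2_scale)

lift_definition inner_hfield :: "hfield \<Rightarrow> hfield \<Rightarrow> real" is "\<lambda>f g. \<integral>k. f k \<bullet> g k \<partial>lborel"
  unfolding hrel_def
  by (intro integral_cong_AE) (auto dest!: transverse_L2_measurable)

definition norm_hfield :: "hfield \<Rightarrow> real" where
  "norm_hfield f = sqrt (f \<bullet> f)"

definition sgn_hfield :: "hfield \<Rightarrow> hfield" where
  "sgn_hfield f = scaleR (inverse (norm f)) f"

definition dist_hfield :: "hfield \<Rightarrow> hfield \<Rightarrow> real" where
  "dist_hfield f g = norm (f - g)"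

definition uniformity_hfield :: "(hfield \<times> hfield) filter" where
  "uniformity_hfield = (INF e\<in>{0 <..}. principal {(f, g). dist f g < e})"

definition open_hfield :: "hfield set \<Rightarrow> bool" where
  "open_hfield U = (\<forall>f\<in>U. eventually (\<lambda>(f', g). f' = f \<longrightarrow> g \<in> U) uniformity)"

instance
proof
  fix f g h :: hfield and c d :: real and U :: "hfield set"
  note intros = transverse_L2_add transverse_L2_diff transverse_L2_minus transverse_L2_scale
  show "f + g + h = f + (g + h)"
    by transfer (auto simp: hrel_def add.assoc intro!: intros)
  show "f + g = g + f"
    by transfer (auto simp: hrel_def add.commute intro!: intros)
  show "0 + f = f"
    by transfer (auto simp: hrel_def)
  show "- f + f = 0"
    by transfer (auto simp: hrel_def)
  show "f - g = f + - g"
    by transfer (auto simp: hrel_def intro!: intros)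
  show "c *\<^sub>R (f + g) = c *\<^sub>R f + c *\<^sub>R g"
    by transfer (auto simp: hrel_def scaleR_add_right intro!: intros)
  show "(c + d) *\<^sub>R f = c *\<^sub>R f + d *\<^sub>R f"
    by transfer (auto simp: hrel_def scaleR_add_left intro!: intros)
  show "c *\<^sub>R d *\<^sub>R f = (c * d) *\<^sub>R f"
    by transfer (auto simp: hrel_def intro!: intros)
  show "1 *\<^sub>R f = f"
    by transfer (auto simp: hrel_def)
  show "dist f g = norm (f - g)" by (rule dist_hfield_def)
  show "sgn f = scaleR (inverse (norm f)) f" by (rule sgn_hfield_def)
  show "uniformity = (INF e\<in>{0 <..}. principal {(f, g :: hfield). dist f g < e})"
    by (rule uniformity_hfield_def)
  show "open U = (\<forall>f\<in>U. eventually (\<lambda>(f', g). f' = f \<longrightarrow> g \<in> U) uniformity)"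
    by (rule open_hfield_def)
  show "norm f = sqrt (f \<bullet> f)" by (rule norm_hfield_def)
  show "f \<bullet> g = g \<bullet> f"
    by transfer (simp add: inner_commute)
  show "(f + g) \<bullet> h = f \<bullet> h + g \<bullet> h"
    by transfer (auto simp: hrel_def inner_add_left transverse_L2_inner
        intro!: Bochner_Integration.integral_add)
  show "c *\<^sub>R f \<bullet> g = c * (f \<bullet> g)"
    by transfer simp
  show "0 \<le> f \<bullet> f"
    by transfer simp
  show "f \<bullet> f = 0 \<longleftrightarrow> f = 0"
  proof transfer
    fix f assume "hrel f f"
    then have f: "transverse_L2 f" by (simp add: hrel_def)
    have "(\<integral>k. f k \<bullet> f k \<partial>lborel) = 0 \<longleftrightarrow> (AE k in lborel. f k \<bullet> f k = 0)"
      by (intro integral_nonneg_eq_0_iff_AE transverse_L2_inner f) auto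
    then show "(\<integral>k. f k \<bullet> f k \<partial>lborel) = 0 \<longleftrightarrow> hrel f (\<lambda>k. 0)"
      using f by (simp add: hrel_def)
  qed
qed

end

lemma norm_hfield_abs:
  assumes "transverse_L2 f"
  shows "(norm (abs_hfield f))\<^sup>2 = (\<integral>k. (norm (f k))\<^sup>2 \<partial>lborel)"
proof -
  have "hrel f f" using assms by (simp add: hrel_def)
  then show ?thesis
    by (simp add: power2_norm_eq_inner inner_hfield.abs_eq)
qed

lemma transverse_L2_rep: "transverse_L2 (rep_hfield f)"
  using Quotient3_rep_reflp[OF Quotient3_hfield, of f] by (simp add: hrel_def)

lemma abs_rep_hfield: "abs_hfield (rep_hfield f) = f"
  by (rule Quotient3_abs_rep[OF Quotient3_hfield])

lemma abs_hfield_diff: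
  "transverse_L2 f \<Longrightarrow> transverse_L2 g \<Longrightarrow> abs_hfield f - abs_hfield g = abs_hfield (\<lambda>k. f k - g k)"
  by (simp add: minus_hfield.abs_eq hrel_def)

lemma nn_integral_norm_hfield:
  assumes "transverse_L2 f"
  shows "(\<integral>\<^sup>+k. ennreal ((norm (f k))\<^sup>2) \<partial>lborel) = ennreal ((norm (abs_hfield f))\<^sup>2)"
  using assms by (simp add: norm_hfield_abs nn_integral_eq_integral transverse_L2_def)

instance hfield :: complete_space
proof
  fix X :: "nat \<Rightarrow> hfield" assume X: "Cauchy X"
  have "\<exists>r. \<forall>n. (\<forall>m\<ge>r n. \<forall>l\<ge>r n. dist (X m) (X l) < (1/2)^n) \<and> r n < r (Suc n)"
  proof (rule dependent_nat_choice)
    show "\<exists>N. \<forall>m\<ge>N. \<forall>l\<ge>N. dist (X m) (X l) < (1/2)^0"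
      using X unfolding Cauchy_def by (metis power_0 zero_less_one)
    fix N n
    obtain K where K: "\<forall>m\<ge>K. \<forall>l\<ge>K. dist (X m) (X l) < (1/2)^(Suc n)"
      using X unfolding Cauchy_def by (metis zero_less_divide_1_iff zero_less_numeral zero_less_power)
    show "\<exists>M. (\<forall>m\<ge>M. \<forall>l\<ge>M. dist (X m) (X l) < (1/2)^(Suc n)) \<and> N < M"
      using K by (intro exI[of _ "max K (Suc N)"]) auto
  qed
  then obtain r where r: "\<And>n m l. r n \<le> m \<Longrightarrow> r n \<le> l \<Longrightarrow> dist (X m) (X l) < (1/2)^n"
    and "\<And>n. r n < r (Suc n)" by metis
  then have mono: "strict_mono r" by (simp add: strict_mono_Suc_iff)
  define F where "F n = rep_hfield (X (r n))" for n
  have F: "transverse_L2 (F n)" and absF: "abs_hfield (F n) = X (r n)" for n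
    by (simp_all add: F_def transverse_L2_rep abs_rep_hfield)
  have [measurable]: "F n \<in> borel_measurable borel" for n
    using F by (rule transverse_L2_measurable)
  have close: "(\<integral>\<^sup>+k. ennreal ((norm (F m k - F n k))\<^sup>2) \<partial>lborel) \<le> ennreal (((1/2)^n)\<^sup>2)"
    if "n \<le> m" for m n
  proof -
    have "norm (X (r m) - X (r n)) \<le> (1/2)^n"
      using r[of n "r m" "r n"] that strict_mono_less_eq[OF mono] by (simp add: dist_norm)
    then show ?thesis
      using F[of m] F[of n]
      by (simp add: nn_integral_norm_hfield transverse_L2_diff abs_hfield_diff[symmetric] absF
          ennreal_leI power_mono)
  qed
  define D where "D n k = (norm (F (Suc n) k - F n k))\<^sup>2" for n k
  have [measurable]: "D n \<in> borel_measurable borel" for n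
    unfolding D_def by measurable
  have D0: "0 \<le> D n k" for n k by (simp add: D_def)
  have "(\<integral>\<^sup>+k. (\<Sum>n. ennreal (2^n * D n k)) \<partial>lborel)
      = (\<Sum>n. \<integral>\<^sup>+k. ennreal (2^n * D n k) \<partial>lborel)"
    by (rule nn_integral_suminf) measurable
  also have "\<dots> \<le> (\<Sum>n. ennreal ((1/2)^n))"
  proof (intro suminf_le)
    fix n
    have "(\<integral>\<^sup>+k. ennreal (2^n * D n k) \<partial>lborel) = ennreal (2^n) * (\<integral>\<^sup>+k. ennreal (D n k) \<partial>lborel)"
      by (simp add: ennreal_mult D0 nn_integral_cmult)
    also have "\<dots> \<le> ennreal (2^n) * ennreal (((1/2)^n)\<^sup>2)"
      using close[of n "Suc n"] by (intro mult_left_mono) (auto simp: D_def)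
    also have "\<dots> = ennreal ((2 * (1/2) * (1/2))^n)"
      unfolding power_mult_distrib power2_eq_square by (simp add: ennreal_mult[symmetric] mult.assoc)
    also have "\<dots> = ennreal ((1/2)^n)" by simp
    finally show "(\<integral>\<^sup>+k. ennreal (2^n * D n k) \<partial>lborel) \<le> ennreal ((1/2)^n)" .
  qed auto
  also have "\<dots> = ennreal (\<Sum>n. (1/2)^n)"
    by (rule suminf_ennreal2) (auto intro: summable_geometric)
  also have "\<dots> < \<infinity>" by simp
  finally have "(\<integral>\<^sup>+k. (\<Sum>n. ennreal (2^n * D n k)) \<partial>lborel) \<noteq> \<infinity>" by simp
  then have "AE k in lborel. (\<Sum>n. ennreal (2^n * D n k)) \<noteq> \<infinity>"
    by (intro nn_integral_PInf_AE) auto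
  then have conv: "AE k in lborel. convergent (\<lambda>n. F n k)"
  proof eventually_elim
    case (elim k)
    then have "summable (\<lambda>n. 2^n * D n k)"
      by (intro summable_suminf_not_top) (auto simp: D0)
    then have "summable (\<lambda>n. (1/2)^n + 2^n * D n k)"
      by (intro summable_add summable_geometric) auto
    then have "summable (\<lambda>n. F (Suc n) k - F n k)"
    proof (rule summable_comparison_test')
      fix n
      define d where "d = norm (F (Suc n) k - F n k)"
      have "2 * ((1::real)/2)^n * (2^n * d) \<le> ((1/2)^n + 2^n * d\<^sup>2)"
      proof -
        have "0 \<le> (1/2)^n * (1 - 2^n * d)\<^sup>2" by simp
        also have "\<dots> = (1/2)^n - 2 * (1/2)^n * (2^n * d) + ((1/2)^n * 2^n) * (2^n * d\<^sup>2)"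
          by (simp add: power2_eq_square algebra_simps)
        also have "((1/2)^n * 2^n :: real) = 1"
          by (simp add: power_mult_distrib[symmetric])
        finally show ?thesis by simp
      qed
      moreover have "2 * ((1::real)/2)^n * (2^n * d) = 2 * d"
        by (simp add: power_divide)
      moreover have "0 \<le> d" by (simp add: d_def)
      ultimately show "norm (F (Suc n) k - F n k) \<le> (1/2)^n + 2^n * D n k"
        unfolding D_def d_def[symmetric] by linarith
    qed
    then have "convergent (\<lambda>n. \<Sum>i<n. F (Suc i) k - F i k)"
      by (simp add: summable_iff_convergent)
    then have "convergent (\<lambda>n. F n k - F 0 k)"
      by (simp only: sum_lessThan_telescope[where f = "\<lambda>n. F n k"])
    then have "convergent (\<lambda>n. (F n k - F 0 k) + F 0 k)"
      by (rule convergent_add[OF _ convergent_const])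
    then show ?case by simp
  qed
  define f where "f k = lim (\<lambda>n. F n k)" for k
  have [measurable]: "f \<in> borel_measurable borel"
    unfolding f_def by measurable
  have lim: "AE k in lborel. (\<lambda>n. F n k) \<longlonglongrightarrow> f k"
    using conv by eventually_elim (simp add: f_def convergent_LIMSEQ_iff[symmetric])
  have bound: "(\<integral>\<^sup>+k. ennreal ((norm (f k - F n k))\<^sup>2) \<partial>lborel) \<le> ennreal (((1/2)^n)\<^sup>2)" for n
  proof -
    have "(\<integral>\<^sup>+k. ennreal ((norm (f k - F n k))\<^sup>2) \<partial>lborel)
        = (\<integral>\<^sup>+k. liminf (\<lambda>m. ennreal ((norm (F m k - F n k))\<^sup>2)) \<partial>lborel)"
    proof (rule nn_integral_cong_AE, use lim in eventually_elim)
      case (elim k)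
      have "(\<lambda>m. ennreal ((norm (F m k - F n k))\<^sup>2)) \<longlonglongrightarrow> ennreal ((norm (f k - F n k))\<^sup>2)"
        by (intro tendsto_ennrealI tendsto_intros elim)
      from lim_imp_Liminf[OF _ this] show ?case by simp
    qed
    also have "\<dots> \<le> liminf (\<lambda>m. \<integral>\<^sup>+k. ennreal ((norm (F m k - F n k))\<^sup>2) \<partial>lborel)"
      by (rule nn_integral_liminf) measurable
    also have "\<dots> \<le> limsup (\<lambda>m. \<integral>\<^sup>+k. ennreal ((norm (F m k - F n k))\<^sup>2) \<partial>lborel)"
      by (rule Liminf_le_Limsup) simp
    also have "\<dots> \<le> ennreal (((1/2)^n)\<^sup>2)"
      by (intro Limsup_bounded eventually_sequentiallyI[of n] close)
    finally show ?thesis .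
  qed
  have "AE k in lborel. \<forall>n. k \<bullet> F n k = 0"
    using F by (simp add: AE_all_countable transverse_L2_def)
  with lim have orth: "AE k in lborel. k \<bullet> f k = 0"
  proof eventually_elim
    case (elim k)
    have "(\<lambda>n. k \<bullet> F n k) \<longlonglongrightarrow> k \<bullet> f k"
      by (intro tendsto_intros elim)
    with elim show ?case by (simp add: LIMSEQ_const_iff)
  qed
  have fF: "transverse_L2 (\<lambda>k. f k - F n k)" for n
  proof -
    have "integrable lborel (\<lambda>k. (norm (f k - F n k))\<^sup>2)"
    proof (rule integrableI_bounded)
      show "(\<integral>\<^sup>+k. ennreal (norm ((norm (f k - F n k))\<^sup>2)) \<partial>lborel) < \<infinity>"
        using le_less_trans[OF bound[of n] ennreal_less_top] by simp
    qed measurable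
    moreover have "AE k in lborel. k \<bullet> (f k - F n k) = 0"
      using orth F[of n] unfolding transverse_L2_def by (auto simp: inner_diff_right)
    ultimately show ?thesis by (simp add: transverse_L2_def)
  qed
  then have f: "transverse_L2 f"
    using transverse_L2_add[OF fF[of 0] F[of 0]] by simp
  have "norm (X (r n) - abs_hfield f) \<le> (1/2)^n" for n
  proof -
    have "ennreal ((norm (abs_hfield (\<lambda>k. f k - F n k)))\<^sup>2) \<le> ennreal (((1/2)^n)\<^sup>2)"
      using bound[of n] unfolding nn_integral_norm_hfield[OF fF] .
    then have "(norm (abs_hfield (\<lambda>k. f k - F n k)))\<^sup>2 \<le> ((1/2)^n)\<^sup>2"
      by (subst (asm) ennreal_le_iff) auto
    then have "norm (abs_hfield (\<lambda>k. f k - F n k)) \<le> (1/2)^n"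
      by (rule power2_le_imp_le) simp
    then show ?thesis
      unfolding abs_hfield_diff[OF f F, symmetric] absF by (simp only: norm_minus_commute)
  qed
  then have "(\<lambda>n. X (r n) - abs_hfield f) \<longlonglongrightarrow> 0"
    by (intro Lim_null_comparison[OF always_eventually LIMSEQ_realpow_zero[of "1/2"]] allI) simp_all
  then have "(X \<circ> r) \<longlonglongrightarrow> abs_hfield f"
    unfolding o_def by (rule LIM_zero_cancel)
  from Cauchy_converges_subseq[OF X mono this] show "convergent X"
    by (auto simp: convergent_def)
qed

instance hfield :: banach ..

lift_definition in_DM :: "hfield \<Rightarrow> bool" is
  "\<lambda>f. integrable lborel (\<lambda>k. (norm (norm k *\<^sub>R f k))\<^sup>2)"
  unfolding hrel_def
  by (intro integrable_cong_AE) (auto dest!: transverse_L2_measurable)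

definition DM :: "hfield set" where
  "DM = {f. in_DM f}"

text \<open>Only the values on \<^term>\<open>DM\<close> matter; off the domain the operator is set to 0.\<close>

lift_definition M_op :: "hfield \<Rightarrow> hfield" is
  "\<lambda>f k. if integrable lborel (\<lambda>k. (norm (norm k *\<^sub>R f k))\<^sup>2) then norm k *\<^sub>R f k else 0"
proof -
  fix f g assume fg: "hrel f g"
  then have [measurable]: "f \<in> borel_measurable borel" "g \<in> borel_measurable borel"
    by (auto simp: hrel_def dest!: transverse_L2_measurable)
  have "integrable lborel (\<lambda>k. (norm (norm k *\<^sub>R f k))\<^sup>2)
      \<longleftrightarrow> integrable lborel (\<lambda>k. (norm (norm k *\<^sub>R g k))\<^sup>2)"
    using fg unfolding hrel_def by (intro integrable_cong_AE) auto
  then show "hrel (\<lambda>k. if integrable lborel (\<lambda>k. (norm (norm k *\<^sub>R f k))\<^sup>2) then norm k *\<^sub>R f k else 0)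
      (\<lambda>k. if integrable lborel (\<lambda>k. (norm (norm k *\<^sub>R g k))\<^sup>2) then norm k *\<^sub>R g k else 0)"
    using fg transverse_L2_mult[of f norm] transverse_L2_mult[of g norm]
    by (auto simp: hrel_def simp del: norm_scaleR)
qed

lift_definition flow_q :: "real \<Rightarrow> hfield \<Rightarrow> hfield \<Rightarrow> hfield" is
  "\<lambda>t q p k. cos (t * norm k) *\<^sub>R q k + sin (t * norm k) *\<^sub>R p k"
  unfolding hrel_def
  by (auto intro!: transverse_L2_add transverse_L2_mult_bounded[where B = 1])

lift_definition flow_p :: "real \<Rightarrow> hfield \<Rightarrow> hfield \<Rightarrow> hfield" is
  "\<lambda>t q p k. (- sin (t * norm k)) *\<^sub>R q k + cos (t * norm k) *\<^sub>R p k"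
  unfolding hrel_def
  by (auto intro!: transverse_L2_add transverse_L2_mult_bounded[where B = 1] simp del: scaleR_minus_left)

definition free_flow :: "real \<Rightarrow> hfield \<times> hfield \<Rightarrow> hfield \<times> hfield" where
  "free_flow t X = (flow_q t (fst X) (snd X), flow_p t (fst X) (snd X))"

definition schwartz :: "(real \<Rightarrow> real) \<Rightarrow> bool" where
  "schwartz f \<longleftrightarrow>
     (\<forall>n r. (deriv ^^ n) f differentiable (at r)) \<and>
     (\<forall>m n. bounded (range (\<lambda>r. r ^ m * (deriv ^^ n) f r)))"

text \<open>
  The values at \<open>k = 0\<close> (where \<open>x / 0 = 0\<close>) are irrelevant.  For a Schwartz cut-off these functions
  represent elements of \<open>H\<close>, see \<open>transverse_L2_a_fun\<close> and \<open>transverse_L2_b_fun\<close>.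
\<close>

definition a_fun :: "(real \<Rightarrow> real) \<Rightarrow> 3 \<Rightarrow> real^3 \<Rightarrow> real^3 \<Rightarrow> real^3" where
  "a_fun chi m x k = (chi (norm k) * sqrt (norm k) / (2 * pi) powr (3/2) * sin (k \<bullet> x)) *\<^sub>R
     (cross3 k (axis m 1) /\<^sub>R norm k)"

definition b_fun :: "(real \<Rightarrow> real) \<Rightarrow> 3 \<Rightarrow> real^3 \<Rightarrow> real^3 \<Rightarrow> real^3" where
  "b_fun chi m x k = (chi (norm k) * sqrt (norm k) / (2 * pi) powr (3/2) * cos (k \<bullet> x)) *\<^sub>R
     (cross3 k (axis m 1) /\<^sub>R norm k)"

lemma integrable_inverse_power5: "integrable lborel (\<lambda>k::real^3. 1 / (1 + norm k) ^ 5)"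
proof (rule integrableI_bounded)
  define g where "g n k = (1 / (real (Suc n)) ^ 5) * indicat_real (cball 0 (real (Suc n))) k"
    for n and k :: "real^3"
  have "(\<integral>\<^sup>+k. ennreal (norm (1 / (1 + norm (k::real^3)) ^ 5)) \<partial>lborel)
      \<le> (\<integral>\<^sup>+k. (\<Sum>n. ennreal (g n k)) \<partial>lborel)"
  proof (rule nn_integral_mono)
    fix k :: "real^3"
    define n where "n = nat \<lfloor>norm k\<rfloor>"
    have n: "real n \<le> norm k" "norm k \<le> real (Suc n)"
      unfolding n_def by (simp_all add: of_nat_nat) linarith
    have "1 / (1 + norm k) ^ 5 \<le> 1 / (real (Suc n)) ^ 5"
      using n by (intro divide_left_mono power_mono mult_pos_pos zero_less_power) (auto simp: add_pos_nonneg)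
    also have "\<dots> = g n k" using n by (simp add: g_def)
    finally have "ennreal (norm (1 / (1 + norm k) ^ 5)) \<le> ennreal (g n k)"
      by (intro ennreal_leI) simp
    also have "\<dots> \<le> (\<Sum>n. ennreal (g n k))"
      using sum_le_suminf[of "\<lambda>n. ennreal (g n k)" "{n}"] by simp
    finally show "ennreal (norm (1 / (1 + norm k) ^ 5)) \<le> (\<Sum>n. ennreal (g n k))" .
  qed
  also have "\<dots> = (\<Sum>n. \<integral>\<^sup>+k. ennreal (g n k) \<partial>lborel)"
  proof (rule nn_integral_suminf)
    fix n
    have "g n \<in> borel_measurable borel"
      unfolding g_def[abs_def]
      by (intro borel_measurable_times borel_measurable_const borel_measurable_indicator) simp
    then show "(\<lambda>k. ennreal (g n k)) \<in> borel_measurable lborel" by simp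
  qed
  also have "\<dots> = (\<Sum>n. ennreal (unit_ball_vol 3 * (1 / (real (Suc n)) ^ 2)))"
  proof (rule suminf_cong)
    fix n
    have "(\<integral>\<^sup>+k. ennreal (g n k) \<partial>lborel)
        = (\<integral>\<^sup>+k. ennreal (1 / (real (Suc n)) ^ 5) * indicator (cball 0 (real (Suc n))) (k::real^3) \<partial>lborel)"
      by (intro nn_integral_cong) (auto simp: g_def split: split_indicator)
    also have "\<dots> = ennreal (1 / (real (Suc n)) ^ 5) * emeasure lborel (cball (0::real^3) (real (Suc n)))"
      by (rule nn_integral_cmult_indicator) simp
    also have "\<dots> = ennreal (1 / (real (Suc n)) ^ 5 * (unit_ball_vol 3 * real (Suc n) ^ 3))"
      by (subst emeasure_cball) (simp_all add: ennreal_mult[symmetric])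
    also have "1 / (real (Suc n)) ^ 5 * (unit_ball_vol 3 * real (Suc n) ^ 3)
        = unit_ball_vol 3 * (1 / (real (Suc n)) ^ 2)"
      by (simp add: field_simps power_eq_if del: of_nat_Suc)
    finally show "(\<integral>\<^sup>+k. ennreal (g n k) \<partial>lborel) = ennreal (unit_ball_vol 3 * (1 / (real (Suc n)) ^ 2))" .
  qed
  also have "\<dots> = ennreal (\<Sum>n. unit_ball_vol 3 * (1 / (real (Suc n)) ^ 2))"
  proof (rule suminf_ennreal2)
    have "summable (\<lambda>n. 1 / (real (Suc n)) ^ 2)"
      using inverse_power_summable[of 2, where ?'a = real]
      by (subst summable_Suc_iff) (simp add: inverse_eq_divide)
    then show "summable (\<lambda>n. unit_ball_vol 3 * (1 / (real (Suc n)) ^ 2))"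
      by (rule summable_mult)
  qed simp
  also have "\<dots> < \<infinity>" by simp
  finally show "(\<integral>\<^sup>+k. ennreal (norm (1 / (1 + norm (k::real^3)) ^ 5)) \<partial>lborel) < \<infinity>" .
qed measurable

lemma schwartz_continuous: "schwartz chi \<Longrightarrow> continuous_on UNIV chi"
  unfolding schwartz_def
  by (metis continuous_at_imp_continuous_on differentiable_imp_continuous_within funpow_0)

lemma transverse_L2_coupling:
  fixes g :: "real^3 \<Rightarrow> real" and e :: "real^3"
  assumes chi: "schwartz chi" and [measurable]: "g \<in> borel_measurable borel"
    and g: "\<And>k. \<bar>g k\<bar> \<le> 1" and e: "norm e = 1"
  shows "transverse_L2 (\<lambda>k. (chi (norm k) * sqrt (norm k) / (2 * pi) powr (3/2) * g k) *\<^sub>R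
           (cross3 k e /\<^sub>R norm k))"
    (is "transverse_L2 ?f")
proof -
  have [measurable]: "chi \<in> borel_measurable borel"
    by (intro borel_measurable_continuous_onI schwartz_continuous chi)
  have "continuous_on UNIV (\<lambda>k. cross3 k e)"
    by (intro continuous_on_cross continuous_intros)
  then have [measurable]: "(\<lambda>k. cross3 k e) \<in> borel_measurable borel"
    by (rule borel_measurable_continuous_onI)
  have meas: "?f \<in> borel_measurable borel" by measurable
  obtain A where A: "\<And>r. \<bar>chi r\<bar> \<le> A"
  proof -
    have "bounded (range (\<lambda>r. r ^ 0 * (deriv ^^ 0) chi r))"
      using chi unfolding schwartz_def by blast
    then show ?thesis using that by (auto simp: bounded_iff)
  qed
  obtain B where B: "\<And>r. \<bar>r ^ 3 * chi r\<bar> \<le> B"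
  proof -
    have "bounded (range (\<lambda>r. r ^ 3 * (deriv ^^ 0) chi r))"
      using chi unfolding schwartz_def by blast
    then show ?thesis using that by (auto simp: bounded_iff)
  qed
  define c where "c = (2 * pi) powr (3/2)"
  have c: "1 \<le> c"
    unfolding c_def using pi_gt3 by (intro ge_one_powr_ge_zero) auto
  have bound: "(norm (?f k))\<^sup>2 \<le> (4 * (A + B))\<^sup>2 * (1 / (1 + norm k) ^ 5)" for k
  proof -
    define r where "r = norm k"
    have r: "0 \<le> r" by (simp add: r_def)
    have "\<bar>chi r\<bar> * (1 + r) ^ 3 \<le> \<bar>chi r\<bar> * (4 * (1 + r ^ 3))"
    proof (rule mult_left_mono)
      have "4 * (1 + r ^ 3) - (1 + r) ^ 3 = 3 * (1 + r) * (1 - r)\<^sup>2"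
        by (simp add: power2_eq_square power3_eq_cube algebra_simps)
      also have "\<dots> \<ge> 0" using r by simp
      finally show "(1 + r) ^ 3 \<le> 4 * (1 + r ^ 3)" by simp
    qed simp
    also have "\<dots> = 4 * (\<bar>chi r\<bar> + \<bar>r ^ 3 * chi r\<bar>)"
      using r by (simp add: abs_mult algebra_simps)
    also have "\<dots> \<le> 4 * (A + B)" using A[of r] B[of r] by simp
    finally have L: "\<bar>chi r\<bar> * (1 + r) ^ 3 \<le> 4 * (A + B)" .
    have cr: "norm (cross3 k e /\<^sub>R norm k) \<le> 1"
    proof (cases "k = 0")
      case False
      have "(norm (cross3 k e))\<^sup>2 \<le> (norm k)\<^sup>2"
        using norm_cross[of k e] e by simp
      then have "norm (cross3 k e) \<le> norm k" by (rule power2_le_imp_le) simp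
      then show ?thesis using False by (simp add: field_simps)
    qed simp
    have "norm (?f k) = (\<bar>chi r\<bar> * sqrt r / c * \<bar>g k\<bar>) * norm (cross3 k e /\<^sub>R norm k)"
      unfolding norm_scaleR r_def[symmetric] c_def[symmetric] using c r
      by (simp add: abs_mult)
    also have "\<dots> \<le> (\<bar>chi r\<bar> * sqrt r / c * 1) * 1"
      using g[of k] cr c r
      by (intro mult_mono mult_nonneg_nonneg divide_nonneg_nonneg) auto
    also have "\<dots> \<le> \<bar>chi r\<bar> * sqrt r"
      using c r mult_left_mono[of 1 c "\<bar>chi r\<bar> * sqrt r"] by (simp add: divide_le_eq)
    finally have "(norm (?f k))\<^sup>2 \<le> (\<bar>chi r\<bar> * sqrt r)\<^sup>2"
      by (intro power_mono) auto
    also have "\<dots> = \<bar>chi r\<bar>\<^sup>2 * r"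
      using r by (simp add: power_mult_distrib)
    also have "\<dots> \<le> \<bar>chi r\<bar>\<^sup>2 * (1 + r)" by (intro mult_left_mono) auto
    also have "\<dots> = (\<bar>chi r\<bar> * (1 + r) ^ 3)\<^sup>2 * (1 / (1 + r) ^ 5)"
    proof -
      have "((1 + r) ^ 3)\<^sup>2 = (1 + r) ^ 5 * (1 + r)"
        unfolding power_mult[symmetric] power_Suc2[symmetric] by simp
      then show ?thesis using r by (simp add: power_mult_distrib)
    qed
    also have "\<dots> \<le> (4 * (A + B))\<^sup>2 * (1 / (1 + r) ^ 5)"
      using L r by (intro mult_right_mono power_mono) auto
    finally show ?thesis by (simp only: r_def)
  qed
  have "integrable lborel (\<lambda>k::real^3. (4 * (A + B))\<^sup>2 * (1 / (1 + norm k) ^ 5))"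
    by (intro integrable_mult_right integrable_inverse_power5)
  then have "integrable lborel (\<lambda>k. (norm (?f k))\<^sup>2)"
  proof (rule Bochner_Integration.integrable_bound)
    show "AE k in lborel. norm ((norm (?f k))\<^sup>2) \<le> norm ((4 * (A + B))\<^sup>2 * (1 / (1 + norm k) ^ 5))"
    proof (intro AE_I2)
      have aux: "norm a \<le> norm b" if "0 \<le> a" "a \<le> b" for a b :: real
        using that by simp
      show "norm ((norm (?f k))\<^sup>2) \<le> norm ((4 * (A + B))\<^sup>2 * (1 / (1 + norm k) ^ 5))" for k
        by (rule aux[OF zero_le_power2 bound])
    qed
  qed (use meas in measurable)
  moreover have "k \<bullet> ?f k = 0" for k
    by (simp add: dot_cross_self)
  ultimately show ?thesis using meas by (simp add: transverse_L2_def)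
qed

lemma transverse_L2_a_fun: "schwartz chi \<Longrightarrow> transverse_L2 (a_fun chi m x)"
  unfolding a_fun_def[abs_def] by (rule transverse_L2_coupling) auto

lemma transverse_L2_b_fun: "schwartz chi \<Longrightarrow> transverse_L2 (b_fun chi m x)"
  unfolding b_fun_def[abs_def] by (rule transverse_L2_coupling) auto

definition a_vec :: "(real \<Rightarrow> real) \<Rightarrow> 3 \<Rightarrow> real^3 \<Rightarrow> hfield" where
  "a_vec chi m x = abs_hfield (a_fun chi m x)"

definition b_vec :: "(real \<Rightarrow> real) \<Rightarrow> 3 \<Rightarrow> real^3 \<Rightarrow> hfield" where
  "b_vec chi m x = abs_hfield (b_fun chi m x)"

definition B_form :: "(real \<Rightarrow> real) \<Rightarrow> 3 \<Rightarrow> real^3 \<Rightarrow> hfield \<times> hfield \<Rightarrow> real" where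
  "B_form chi m x X = a_vec chi m x \<bullet> fst X + b_vec chi m x \<bullet> snd X"

definition dagger :: "complex^'i^'j \<Rightarrow> complex^'j^'i" where
  "dagger A = (\<chi> i j. cnj (A $ j $ i))"

typedef 'i su = "{X :: complex^('i::finite)^'i. dagger X = - X \<and> trace X = 0}"
  by (rule exI[of _ 0]) (simp add: dagger_def vec_eq_iff trace_def)

setup_lifting type_definition_su

lemma dagger_mult: "dagger (A ** B) = dagger B ** dagger A"
  by (simp add: dagger_def matrix_matrix_mult_def vec_eq_iff mult.commute)

lemma dagger_diff: "dagger (A - B) = dagger A - dagger B"
  by (simp add: dagger_def vec_eq_iff)

lemma trace_dagger: "trace (dagger X) = cnj (trace X)"
  by (simp add: trace_def dagger_def)

lemma trace_mult_antihermitian: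
  assumes "dagger X = - X"
  shows "- trace (X ** Y) = (\<Sum>i\<in>UNIV. \<Sum>j\<in>UNIV. cnj (X $ i $ j) * Y $ i $ j)"
proof -
  have X: "- X $ i $ j = cnj (X $ j $ i)" for i j
    using arg_cong[OF assms, of "\<lambda>Z. Z $ i $ j"] by (simp add: dagger_def)
  have "- trace (X ** Y) = (\<Sum>i\<in>UNIV. \<Sum>j\<in>UNIV. - (X $ i $ j) * Y $ j $ i)"
    by (simp add: trace_def matrix_matrix_mult_def sum_negf)
  also have "\<dots> = (\<Sum>i\<in>UNIV. \<Sum>j\<in>UNIV. cnj (X $ j $ i) * Y $ j $ i)"
    by (simp only: X)
  also have "\<dots> = (\<Sum>i\<in>UNIV. \<Sum>j\<in>UNIV. cnj (X $ i $ j) * Y $ i $ j)"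
    by (rule sum.swap)
  finally show ?thesis .
qed

instantiation su :: (finite) real_inner
begin

lift_definition zero_su :: "'a su" is 0
  by (simp add: dagger_def vec_eq_iff trace_def)

lift_definition plus_su :: "'a su \<Rightarrow> 'a su \<Rightarrow> 'a su" is "(+)"
  by (auto simp: dagger_def vec_eq_iff trace_add)

lift_definition minus_su :: "'a su \<Rightarrow> 'a su \<Rightarrow> 'a su" is "(-)"
  by (auto simp: dagger_def vec_eq_iff trace_sub)

lift_definition uminus_su :: "'a su \<Rightarrow> 'a su" is uminus
  by (auto simp: dagger_def vec_eq_iff trace_def sum_negf)

lift_definition scaleR_su :: "real \<Rightarrow> 'a su \<Rightarrow> 'a su" is "(*\<^sub>R)"
  by (auto simp: dagger_def vec_eq_iff trace_def scaleR_sum_right[symmetric])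

lift_definition inner_su :: "'a su \<Rightarrow> 'a su \<Rightarrow> real" is "\<lambda>X Y. - Re (trace (X ** Y))" .

definition norm_su :: "'a su \<Rightarrow> real" where
  "norm_su X = sqrt (X \<bullet> X)"

definition sgn_su :: "'a su \<Rightarrow> 'a su" where
  "sgn_su X = scaleR (inverse (norm X)) X"

definition dist_su :: "'a su \<Rightarrow> 'a su \<Rightarrow> real" where
  "dist_su X Y = norm (X - Y)"

definition uniformity_su :: "('a su \<times> 'a su) filter" where
  "uniformity_su = (INF e\<in>{0 <..}. principal {(X, Y). dist X Y < e})"

definition open_su :: "'a su set \<Rightarrow> bool" where
  "open_su U = (\<forall>X\<in>U. eventually (\<lambda>(X', Y). X' = X \<longrightarrow> Y \<in> U) uniformity)"

instance
proof
  fix X Y Z :: "'a su" and c d :: real and U :: "'a su set"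
  show "X + Y + Z = X + (Y + Z)" "X + Y = Y + X" "0 + X = X" "- X + X = 0" "X - Y = X + - Y"
    by (transfer, simp)+
  show "c *\<^sub>R (X + Y) = c *\<^sub>R X + c *\<^sub>R Y" "(c + d) *\<^sub>R X = c *\<^sub>R X + d *\<^sub>R X"
    "c *\<^sub>R d *\<^sub>R X = (c * d) *\<^sub>R X" "1 *\<^sub>R X = X"
    by (transfer, simp add: scaleR_add_right scaleR_add_left)+
  show "dist X Y = norm (X - Y)" by (rule dist_su_def)
  show "sgn X = scaleR (inverse (norm X)) X" by (rule sgn_su_def)
  show "uniformity = (INF e\<in>{0 <..}. principal {(X, Y :: 'a su). dist X Y < e})"
    by (rule uniformity_su_def)
  show "open U = (\<forall>X\<in>U. eventually (\<lambda>(X', Y). X' = X \<longrightarrow> Y \<in> U) uniformity)"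
    by (rule open_su_def)
  show "norm X = sqrt (X \<bullet> X)" by (rule norm_su_def)
  show "X \<bullet> Y = Y \<bullet> X"
    by transfer (metis trace_mul_sym)
  show "(X + Y) \<bullet> Z = X \<bullet> Z + Y \<bullet> Z"
    by transfer (simp add: trace_def matrix_matrix_mult_def sum.distrib algebra_simps)
  show "c *\<^sub>R X \<bullet> Y = c * (X \<bullet> Y)"
    by transfer (simp add: trace_def matrix_matrix_mult_def sum_distrib_left scaleR_sum_right[symmetric])
  have self: "X \<bullet> X = (\<Sum>i\<in>UNIV. \<Sum>j\<in>UNIV. (cmod (Rep_su X $ i $ j))\<^sup>2)"
  proof transfer
    fix X :: "complex^'a^'a"
    assume "dagger X = - X \<and> trace X = 0"
    then have "- trace (X ** X) = (\<Sum>i\<in>UNIV. \<Sum>j\<in>UNIV. cnj (X $ i $ j) * X $ i $ j)"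
      by (intro trace_mult_antihermitian) simp
    from arg_cong[OF this, of Re]
    show "- Re (trace (X ** X)) = (\<Sum>i\<in>UNIV. \<Sum>j\<in>UNIV. (cmod (X $ i $ j))\<^sup>2)"
      by (simp add: cmod_power2) (simp add: power2_eq_square)
  qed
  show "0 \<le> X \<bullet> X"
    unfolding self by (intro sum_nonneg) auto
  show "X \<bullet> X = 0 \<longleftrightarrow> X = 0"
    unfolding self
    by (simp add: sum_nonneg_eq_0_iff sum_nonneg vec_eq_iff Rep_su_inject[symmetric] zero_su.rep_eq)
qed

end

lemma inner_su_eq_trace: "complex_of_real (X \<bullet> Y) = - trace (Rep_su X ** Rep_su Y)"
proof transfer
  fix X Y :: "complex^'a^'a"
  assume X: "dagger X = - X \<and> trace X = 0" and Y: "dagger Y = - Y \<and> trace Y = 0"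
  have "cnj (trace (X ** Y)) = trace (dagger Y ** dagger X)"
    by (simp only: trace_dagger[symmetric] dagger_mult)
  also have "\<dots> = trace (Y ** X)"
    using X Y by (simp add: matrix_matrix_mult_def trace_def)
  also have "\<dots> = trace (X ** Y)" by (rule trace_mul_sym)
  finally have "Im (trace (X ** Y)) = 0"
    by (metis cnj.simps(2) neg_equal_zero)
  then show "complex_of_real (- Re (trace (X ** Y))) = - trace (X ** Y)"
    by (simp add: complex_eq_iff)
qed

lift_definition su_bracket :: "'i::finite su \<Rightarrow> 'i su \<Rightarrow> 'i su" is "\<lambda>X Y. X ** Y - Y ** X"
proof (intro conjI)
  fix X Y :: "complex^'i^'i"
  assume X: "dagger X = - X \<and> trace X = 0" and Y: "dagger Y = - Y \<and> trace Y = 0"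
  have neg: "(- A) ** (- B) = A ** B" for A B :: "complex^'i^'i"
    by (simp add: matrix_matrix_mult_def vec_eq_iff)
  show "dagger (X ** Y - Y ** X) = - (X ** Y - Y ** X)"
    using X Y by (simp add: dagger_diff dagger_mult neg)
  show "trace (X ** Y - Y ** X) = 0"
    using trace_mul_sym[of X Y] by (simp add: trace_sub)
qed

text \<open>
  The factors of the tensor product are indexed by a finite type \<open>'n\<close> with \<open>N\<close> elements.  The
  space \<open>(\<complex>\<^sup>2)\<^bsup>\<otimes>N\<^esup>\<close> is \<open>complex ^ ('n \<Rightarrow> 2)\<close>, coordinates being taken with respect
  to the basis of pure tensors of canonical basis vectors: the pure tensor of vectors \<open>v \<mu>\<close> has
  coordinates \<open>\<Prod>\<mu>. v \<mu> $ s \<mu>\<close>.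
\<close>

definition pauli :: "3 \<Rightarrow> complex^2^2" where
  "pauli m =
     (if m = 1 then vector [vector [0, 1], vector [1, 0]]
      else if m = 2 then vector [vector [0, - \<i>], vector [\<i>, 0]]
      else vector [vector [1, 0], vector [0, - 1]])"

definition site_op :: "'n::finite \<Rightarrow> complex^2^2 \<Rightarrow> complex^('n \<Rightarrow> 2)^('n \<Rightarrow> 2)" where
  "site_op l A = (\<chi> s s'. if \<forall>\<mu>. \<mu> \<noteq> l \<longrightarrow> s \<mu> = s' \<mu> then A $ s l $ s' l else 0)"

definition pure_tensor :: "('n::finite \<Rightarrow> complex^2) \<Rightarrow> complex^('n \<Rightarrow> 2)" where
  "pure_tensor v = (\<chi> s. \<Prod>\<mu>\<in>UNIV. v \<mu> $ s \<mu>)"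

lemma site_op_pure_tensor: "site_op l A *v pure_tensor v = pure_tensor (v(l := A *v v l))"
proof -
  have "(\<Sum>s'\<in>UNIV. (if \<forall>\<mu>. \<mu> \<noteq> l \<longrightarrow> s \<mu> = s' \<mu> then A $ s l $ s' l else 0) * (\<Prod>\<mu>\<in>UNIV. v \<mu> $ s' \<mu>))
      = (\<Prod>\<mu>\<in>UNIV. (v(l := A *v v l)) \<mu> $ s \<mu>)" for s
  proof -
    let ?P = "\<Prod>\<mu>\<in>UNIV - {l}. v \<mu> $ s \<mu>"
    have "(\<Sum>s'\<in>UNIV. (if \<forall>\<mu>. \<mu> \<noteq> l \<longrightarrow> s \<mu> = s' \<mu> then A $ s l $ s' l else 0) * (\<Prod>\<mu>\<in>UNIV. v \<mu> $ s' \<mu>))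
        = (\<Sum>s'\<in>range (\<lambda>c. s(l := c)). A $ s l $ s' l * (\<Prod>\<mu>\<in>UNIV. v \<mu> $ s' \<mu>))"
    proof (rule sum.mono_neutral_cong_right)
      have eq: "s' \<in> range (\<lambda>c. s(l := c)) \<longleftrightarrow> (\<forall>\<mu>. \<mu> \<noteq> l \<longrightarrow> s \<mu> = s' \<mu>)" for s'
        by (auto simp: image_iff fun_eq_iff)
      show "\<forall>s'\<in>UNIV - range (\<lambda>c. s(l := c)).
          (if \<forall>\<mu>. \<mu> \<noteq> l \<longrightarrow> s \<mu> = s' \<mu> then A $ s l $ s' l else 0) * (\<Prod>\<mu>\<in>UNIV. v \<mu> $ s' \<mu>) = 0"
      proof
        fix s' assume "s' \<in> UNIV - range (\<lambda>c. s(l := c))"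
        then have "\<not> (\<forall>\<mu>. \<mu> \<noteq> l \<longrightarrow> s \<mu> = s' \<mu>)" using eq by blast
        then show "(if \<forall>\<mu>. \<mu> \<noteq> l \<longrightarrow> s \<mu> = s' \<mu> then A $ s l $ s' l else 0) * (\<Prod>\<mu>\<in>UNIV. v \<mu> $ s' \<mu>) = 0"
          by (simp only: if_False mult_zero_left)
      qed
      show "(if \<forall>\<mu>. \<mu> \<noteq> l \<longrightarrow> s \<mu> = s' \<mu> then A $ s l $ s' l else 0) * (\<Prod>\<mu>\<in>UNIV. v \<mu> $ s' \<mu>)
          = A $ s l $ s' l * (\<Prod>\<mu>\<in>UNIV. v \<mu> $ s' \<mu>)" if "s' \<in> range (\<lambda>c. s(l := c))" for s'
        using that eq[of s'] by (simp only: if_P)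
    qed simp_all
    also have "\<dots> = (\<Sum>c\<in>UNIV. A $ s l $ c * (\<Prod>\<mu>\<in>UNIV. v \<mu> $ (s(l := c)) \<mu>))"
      by (subst sum.reindex) (auto simp: inj_on_def fun_eq_iff dest: fun_cong[of _ _ l])
    also have "\<dots> = (\<Sum>c\<in>UNIV. A $ s l $ c * v l $ c) * ?P"
      by (simp add: prod.remove[of UNIV l] sum_distrib_right mult.assoc)
    also have "\<dots> = (\<Prod>\<mu>\<in>UNIV. (v(l := A *v v l)) \<mu> $ s \<mu>)"
      by (simp add: prod.remove[of UNIV l] matrix_vector_mult_def)
    finally show ?thesis .
  qed
  then show ?thesis
    by (simp add: vec_eq_iff site_op_def pure_tensor_def matrix_vector_mult_def)
qed

lemma trace_site_op_pauli: "trace (site_op l (pauli m)) = 0"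
proof -
  have "(\<Sum>s\<in>UNIV. pauli m $ s l $ s l) = 0"
  proof -
    define flip :: "2 \<Rightarrow> 2" where "flip c = (if c = 1 then 2 else 1)" for c
    have flip2: "flip (flip c) = c" for c
      using exhaust_2[of c] by (auto simp: flip_def)
    have neg: "pauli m $ flip c $ flip c = - pauli m $ c $ c" for c
      using exhaust_2[of c] by (auto simp: flip_def pauli_def)
    have "(\<Sum>s\<in>UNIV. pauli m $ s l $ s l) = (\<Sum>s\<in>UNIV. - pauli m $ s l $ s l)"
      by (rule sum.reindex_bij_witness[of _ "\<lambda>s. s(l := flip (s l))" "\<lambda>s. s(l := flip (s l))"])
         (auto simp: flip2 neg)
    then show ?thesis by (simp add: sum_negf)
  qed
  then show ?thesis by (simp add: trace_def site_op_def)
qed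

lemma dagger_pauli: "dagger (pauli m) = pauli m"
  by (simp add: dagger_def pauli_def vec_eq_iff forall_2)

lift_definition i_sigma :: "3 \<Rightarrow> 'n::finite \<Rightarrow> ('n \<Rightarrow> 2) su" is
  "\<lambda>m l. (\<chi> s s'. \<i> * site_op l (pauli m) $ s $ s')"
proof (intro conjI)
  fix m and l :: 'n
  have herm: "cnj (pauli m $ c $ d) = pauli m $ d $ c" for c d
    using arg_cong[OF dagger_pauli, of "\<lambda>Z. Z $ d $ c" m] by (simp add: dagger_def)
  show "dagger (\<chi> s s'. \<i> * site_op l (pauli m) $ s $ s') = - (\<chi> s s'. \<i> * site_op l (pauli m) $ s $ s')"
    by (auto simp: dagger_def vec_eq_iff site_op_def herm)
  show "trace (\<chi> s s'. \<i> * site_op l (pauli m) $ s $ s') = 0"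
    using trace_site_op_pauli[of l m] by (simp add: trace_def sum_distrib_left[symmetric])
qed

text \<open>
  The dual of the Lie algebra is the space of bounded linear functionals, i.e. of all linear
  functionals since the Lie algebra is finite-dimensional.  Its operator norm is the norm of the
  dual Euclidean structure.
\<close>

type_synonym 'n su_dual = "('n \<Rightarrow> 2) su \<Rightarrow>\<^sub>L real"

type_synonym 'n state = "(hfield \<times> hfield) \<times> 'n su_dual"

text \<open>
  The integral from 0 to \<open>t\<close>, for either sign of \<open>t\<close>.  It is only applied to functions that are
  continuous (hence integrable, the target spaces being complete) along continuous trajectories.
\<close>

definition oriented_integral :: "real \<Rightarrow> (real \<Rightarrow> 'b::real_normed_vector) \<Rightarrow> 'b" where
  "oriented_integral t f = (if 0 \<le> t then integral {0..t} f else - integral {t..0} f)"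

definition source_q ::
  "real \<Rightarrow> (real \<Rightarrow> real) \<Rightarrow> ('n::finite \<Rightarrow> real^3) \<Rightarrow> 'n su_dual \<Rightarrow> hfield" where
  "source_q h chi x \<omega> =
     h *\<^sub>R (\<Sum>l\<in>UNIV. \<Sum>m\<in>UNIV. blinfun_apply \<omega> (i_sigma m l) *\<^sub>R b_vec chi m (x l))"

definition source_p ::
  "real \<Rightarrow> (real \<Rightarrow> real) \<Rightarrow> ('n::finite \<Rightarrow> real^3) \<Rightarrow> 'n su_dual \<Rightarrow> hfield" where
  "source_p h chi x \<omega> =
     - (h *\<^sub>R (\<Sum>l\<in>UNIV. \<Sum>m\<in>UNIV. blinfun_apply \<omega> (i_sigma m l) *\<^sub>R a_vec chi m (x l)))"

definition spin_term ::
  "(real \<Rightarrow> real) \<Rightarrow> real^3 \<Rightarrow> ('n::finite \<Rightarrow> real^3) \<Rightarrow> 'n state \<Rightarrow> ('n \<Rightarrow> 2) su \<Rightarrow>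
     'n \<Rightarrow> 3 \<Rightarrow> real" where
  "spin_term chi \<beta> x u Y l m =
     (\<beta> $ m + B_form chi m (x l) (fst u)) * blinfun_apply (snd u) (su_bracket (i_sigma m l) Y)"

definition weak_solution ::
  "real \<Rightarrow> (real \<Rightarrow> real) \<Rightarrow> real^3 \<Rightarrow> ('n::finite \<Rightarrow> real^3) \<Rightarrow> (real \<Rightarrow> 'n state) \<Rightarrow> bool" where
  "weak_solution h chi \<beta> x u \<longleftrightarrow>
     continuous_on UNIV u \<and>
     (\<forall>t. fst (u t) = free_flow t (fst (u 0)) +
        oriented_integral t
          (\<lambda>s. free_flow (t - s) (source_q h chi x (snd (u s)), source_p h chi x (snd (u s))))) \<and>
     (\<forall>Y t. blinfun_apply (snd (u t)) Y = blinfun_apply (snd (u 0)) Y +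
        (\<Sum>l\<in>UNIV. \<Sum>m\<in>UNIV. oriented_integral t (\<lambda>s. spin_term chi \<beta> x (u s) Y l m)))"

text \<open>Continuity with values in \<^term>\<open>DM\<close> refers to the graph norm of the operator.\<close>

definition strong_solution ::
  "real \<Rightarrow> (real \<Rightarrow> real) \<Rightarrow> real^3 \<Rightarrow> ('n::finite \<Rightarrow> real^3) \<Rightarrow> (real \<Rightarrow> 'n state) \<Rightarrow> bool" where
  "strong_solution h chi \<beta> x u \<longleftrightarrow>
     (let q = (\<lambda>t. fst (fst (u t))); p = (\<lambda>t. snd (fst (u t))); \<omega> = (\<lambda>t. snd (u t)) in
       (\<forall>t. q t \<in> DM \<and> p t \<in> DM) \<and>
       continuous_on UNIV u \<and>
       continuous_on UNIV (\<lambda>t. M_op (q t)) \<and> continuous_on UNIV (\<lambda>t. M_op (p t)) \<and>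
       u C1_differentiable_on UNIV \<and>
       (\<forall>t. (q has_vector_derivative M_op (p t) + source_q h chi x (\<omega> t)) (at t)) \<and>
       (\<forall>t. (p has_vector_derivative - M_op (q t) + source_p h chi x (\<omega> t)) (at t)) \<and>
       (\<forall>Y t. ((\<lambda>s. blinfun_apply (\<omega> s) Y) has_real_derivative
          (\<Sum>l\<in>UNIV. \<Sum>m\<in>UNIV. spin_term chi \<beta> x (u t) Y l m)) (at t)))"

end

theory Submission
  imports Defs
begin

text \<open>
  In the interaction picture \<open>Y(t) = R\<^bsub>-t\<^esub> X(t)\<close> the unbounded operator disappears and the system becomes an
  ordinary differential equation whose right-hand side is continuous and quadratic in \<open>(Y, \<omega>)\<close>.
  Since \<open>\<omega>\<close> evolves by the coadjoint action, its norm is conserved, and then \<open>Y\<close> grows at most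
  linearly.  These bounds persist when the arguments of the right-hand side are retracted radially
  onto balls slightly larger than the bounds.  The retracted equation is
  globally Lipschitz, so Picard iteration solves it uniquely on the whole line, and its solution
  is the solution of the original equation.

  For the regularity, the domain of \<open>M\<close> is the range of \<open>(1 + M)\<inverse>\<close>, which commutes with the flow.
  The vectors \<open>a\<^sub>m(x)\<close>, \<open>b\<^sub>m(x)\<close> lie in this range, because \<open>r \<mapsto> (1 + r) \<chi>(r)\<close> is again a
  Schwartz function.  Hence \<open>Y = (1 + M)\<inverse> Z\<close> with \<open>Z\<close> of class \<open>C\<^sup>1\<close>, and \<open>X(t) = R\<^sub>t (1 + M)\<inverse> Z(t)\<close> can be
  differentiated by the product rule.
\<close>

subsection \<open>Picard iteration on the real line\<close>

lemma continuous_on_UNIV_integrable: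
  fixes f :: "real \<Rightarrow> 'b::banach"
  assumes "continuous_on UNIV f"
  shows "f integrable_on {a..b}"
  using assms by (intro integrable_continuous_real) (rule continuous_on_subset, auto)

lemma oriented_integral_linear:
  fixes f :: "real \<Rightarrow> 'b::banach" and T :: "'b \<Rightarrow> 'c::banach"
  assumes "bounded_linear T" "continuous_on UNIV f"
  shows "oriented_integral t (\<lambda>s. T (f s)) = T (oriented_integral t f)"
proof -
  have "integral {a..b} (\<lambda>s. T (f s)) = T (integral {a..b} f)" for a b
    using integral_linear[OF continuous_on_UNIV_integrable[OF assms(2)] assms(1)] by (simp add: o_def)
  then show ?thesis
    by (simp add: oriented_integral_def linear_neg[OF bounded_linear.linear[OF assms(1)]])
qed

lemma oriented_integral_diff:
  fixes f g :: "real \<Rightarrow> 'b::banach"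
  assumes "continuous_on UNIV f" "continuous_on UNIV g"
  shows "oriented_integral t (\<lambda>s. f s - g s) = oriented_integral t f - oriented_integral t g"
  by (simp add: oriented_integral_def integral_diff continuous_on_UNIV_integrable assms)

lemma oriented_integral_sum:
  fixes f :: "'i \<Rightarrow> real \<Rightarrow> 'b::banach"
  assumes "finite I" "\<And>i. i \<in> I \<Longrightarrow> continuous_on UNIV (f i)"
  shows "oriented_integral t (\<lambda>s. \<Sum>i\<in>I. f i s) = (\<Sum>i\<in>I. oriented_integral t (f i))"
  by (simp add: oriented_integral_def integral_sum continuous_on_UNIV_integrable assms sum_negf)

lemma oriented_integral_0 [simp]: "oriented_integral 0 f = 0"
  by (simp add: oriented_integral_def)

text \<open>The substitution s -> -s; it lets estimates proved for nonnegative times be reused for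
  negative ones.\<close>

lemma oriented_integral_reflect:
  "oriented_integral (- t) (\<lambda>s. f (- s)) = - oriented_integral t f"
  using Henstock_Kurzweil_Integration.integral_reflect_real[of t 0 f]
    Henstock_Kurzweil_Integration.integral_reflect_real[of 0 t f]
  by (auto simp: oriented_integral_def)

lemma has_vector_derivative_oriented_integral:
  fixes f :: "real \<Rightarrow> 'b::banach"
  assumes "continuous_on UNIV f"
  shows "((\<lambda>t. oriented_integral t f) has_vector_derivative f t) (at t)"
proof -
  \<comment> \<open>The integral is rebased at \<open>a\<close>, which lies to the left of both 0
    and t. On \<open>{a<..<b}\<close> it then differs from \<open>integral {a..s} f\<close> by a
    constant, whatever the sign of s. This covers t = 0, where \<open>oriented_integral\<close>
    changes branch.\<close>
  define a b where "a = - \<bar>t\<bar> - 1" and "b = \<bar>t\<bar> + 1"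
  have ab: "a < t" "t < b" "a < 0" "0 < b" by (auto simp: a_def b_def)
  have eq: "oriented_integral s f = integral {a..s} f - integral {a..0} f" if "s \<in> {a<..<b}" for s
  proof (cases "0 \<le> s")
    case True
    then show ?thesis
      using Henstock_Kurzweil_Integration.integral_combine[OF _ True continuous_on_UNIV_integrable[OF assms], of a] ab
      by (auto simp: oriented_integral_def algebra_simps)
  next
    case False
    then show ?thesis
      using Henstock_Kurzweil_Integration.integral_combine[OF _ _ continuous_on_UNIV_integrable[OF assms], of a s 0] that
      by (auto simp: oriented_integral_def algebra_simps)
  qed
  have "((\<lambda>s. integral {a..s} f) has_vector_derivative f t) (at t within {a..b})"
    using ab assms by (intro integral_has_vector_derivative) (auto intro: continuous_on_subset)
  then have "((\<lambda>s. integral {a..s} f) has_vector_derivative f t) (at t)"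
    using ab by (simp add: at_within_Icc_at)
  then have "((\<lambda>s. integral {a..s} f - integral {a..0} f) has_vector_derivative f t) (at t)"
    by (auto intro!: derivative_eq_intros)
  then show ?thesis
    by (rule has_vector_derivative_transform_within_open[where S = "{a<..<b}"]) (use ab eq in auto)
qed

lemma continuous_on_oriented_integral:
  fixes f :: "real \<Rightarrow> 'b::banach"
  assumes "continuous_on UNIV f"
  shows "continuous_on UNIV (\<lambda>t. oriented_integral t f)"
  by (rule continuous_at_imp_continuous_on)
     (use has_vector_derivative_continuous has_vector_derivative_oriented_integral[OF assms] in blast)

text \<open>A monomial majorant is integrated exactly. The gain of one power of |t| and of the
  factor 1 / (n + 1) is what builds up the factorials in the Picard iteration; the case n = 0 later
  gives the linear growth bound.\<close>

lemma norm_oriented_integral_le: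
  fixes f :: "real \<Rightarrow> 'b::banach"
  assumes cont: "continuous_on UNIV f"
    and le: "\<And>s. \<bar>s\<bar> \<le> \<bar>t\<bar> \<Longrightarrow> norm (f s) \<le> c * \<bar>s\<bar> ^ n"
  shows "norm (oriented_integral t f) \<le> c * \<bar>t\<bar> ^ Suc n / real (Suc n)"
proof -
  have pos: "norm (oriented_integral t f) \<le> c * t ^ Suc n / real (Suc n)"
    if t: "0 \<le> t" and cont: "continuous_on UNIV f" and le: "\<And>s. \<bar>s\<bar> \<le> \<bar>t\<bar> \<Longrightarrow> norm (f s) \<le> c * \<bar>s\<bar> ^ n"
    for t and f :: "real \<Rightarrow> 'b"
  proof -
    have "((\<lambda>s. c * s ^ n) has_integral c * t ^ Suc n / real (Suc n) - c * 0 ^ Suc n / real (Suc n)) {0..t}"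
      using t
      by (intro fundamental_theorem_of_calculus)
         (auto intro!: derivative_eq_intros simp: has_real_derivative_iff_has_vector_derivative[symmetric]
           simp del: of_nat_Suc power_Suc)
    then have I: "((\<lambda>s. c * s ^ n) has_integral c * t ^ Suc n / real (Suc n)) {0..t}" by simp
    have "norm (integral {0..t} f) \<le> integral {0..t} (\<lambda>s. c * s ^ n)"
    proof (rule integral_norm_bound_integral)
      show "norm (f s) \<le> c * s ^ n" if "s \<in> {0..t}" for s
        using le[of s] that by auto
    qed (use I continuous_on_UNIV_integrable[OF cont] in \<open>auto simp: has_integral_iff\<close>)
    then show ?thesis using t I by (simp add: oriented_integral_def has_integral_iff)
  qed
  show ?thesis
  proof (cases "0 \<le> t")
    case True
    then show ?thesis using pos[OF True cont le] by simp
  next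
    case False
    have "continuous_on UNIV (\<lambda>s. f (- s))"
      by (rule continuous_on_compose2[OF cont]) (auto intro: continuous_intros)
    then have "norm (oriented_integral (- t) (\<lambda>s. f (- s))) \<le> c * (- t) ^ Suc n / real (Suc n)"
      using False le[of "- _"] by (intro pos) auto
    then show ?thesis using False by (simp add: oriented_integral_reflect)
  qed
qed

text \<open>One step of the iteration. Here \<open>f\<close> and \<open>g\<close> stand for the
  values of a Lipschitz field along two curves and \<open>d\<close> for the distance of these
  curves. Integrating the Lipschitz bound replaces the n-th term of an exponential series by the
  next one.\<close>

lemma picard_step:
  fixes f g :: "real \<Rightarrow> 'b::banach"
  assumes "continuous_on UNIV f" "continuous_on UNIV g"
    and le: "\<And>s. \<bar>s\<bar> \<le> T \<Longrightarrow> norm (f s - g s) \<le> L * d s"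
    and d: "\<And>s. \<bar>s\<bar> \<le> T \<Longrightarrow> d s \<le> B * L ^ n * \<bar>s\<bar> ^ n / fact n"
    and "0 \<le> L" "\<bar>t\<bar> \<le> T"
  shows "norm (oriented_integral t f - oriented_integral t g) \<le> B * L ^ Suc n * \<bar>t\<bar> ^ Suc n / fact (Suc n)"
proof -
  have "norm (oriented_integral t (\<lambda>s. f s - g s)) \<le> (B * L ^ Suc n / fact n) * \<bar>t\<bar> ^ Suc n / real (Suc n)"
  proof (rule norm_oriented_integral_le)
    fix s assume "\<bar>s\<bar> \<le> \<bar>t\<bar>"
    then have "\<bar>s\<bar> \<le> T" using assms by simp
    then have "norm (f s - g s) \<le> L * (B * L ^ n * \<bar>s\<bar> ^ n / fact n)"
      using le[of s] mult_left_mono[OF d \<open>0 \<le> L\<close>, of s] by linarith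
    then show "norm (f s - g s) \<le> B * L ^ Suc n / fact n * \<bar>s\<bar> ^ n" by (simp add: mult_ac)
  qed (intro continuous_intros assms)
  then show ?thesis by (simp add: oriented_integral_diff assms(1,2) field_simps)
qed

lemma exp_terms_tendsto_0:
  fixes c r :: real
  shows "(\<lambda>n. c * r ^ n / fact n) \<longlonglongrightarrow> 0"
proof -
  have "(\<lambda>n. c * (inverse (fact n) * r ^ n)) \<longlonglongrightarrow> c * 0"
    by (intro tendsto_mult tendsto_const summable_LIMSEQ_zero summable_exp)
  then show ?thesis by (simp add: field_simps)
qed

text \<open>On a compact interval the difference of two solutions is bounded by some B. Inserting
  this bound n times into the integral equation improves it to B (L |t|)^n / n!, which tends to 0.
  The Lipschitz constant must be uniform in the state but may depend on the time bound
  \<open>T\<close>.\<close>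

lemma picard_unique:
  fixes F :: "real \<Rightarrow> 'b::banach \<Rightarrow> 'b"
  assumes lip: "\<And>T. \<exists>L\<ge>0. \<forall>t u v. \<bar>t\<bar> \<le> T \<longrightarrow> norm (F t u - F t v) \<le> L * norm (u - v)"
    and cont: "\<And>u. continuous_on UNIV u \<Longrightarrow> continuous_on UNIV (\<lambda>t. F t (u t))"
    and u: "continuous_on UNIV u" "\<And>t. u t = v0 + oriented_integral t (\<lambda>s. F s (u s))"
    and v: "continuous_on UNIV v" "\<And>t. v t = v0 + oriented_integral t (\<lambda>s. F s (v s))"
  shows "u = v"
proof
  fix t :: real
  define T where "T = \<bar>t\<bar>"
  obtain L where L: "0 \<le> L" "\<And>t u v. \<bar>t\<bar> \<le> T \<Longrightarrow> norm (F t u - F t v) \<le> L * norm (u - v)"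
    using lip[of T] by auto
  have "bounded ((\<lambda>s. u s - v s) ` {-T..T})"
    using u(1) v(1) by (intro compact_imp_bounded compact_continuous_image continuous_intros)
      (auto intro: continuous_on_subset)
  then obtain B where B: "\<And>s. s \<in> {-T..T} \<Longrightarrow> norm (u s - v s) \<le> B"
    unfolding bounded_iff by blast
  have "\<forall>s. \<bar>s\<bar> \<le> T \<longrightarrow> norm (u s - v s) \<le> B * L ^ n * \<bar>s\<bar> ^ n / fact n" for n
  proof (induction n)
    case 0
    then show ?case using B by (auto simp: abs_le_iff)
  next
    case (Suc n)
    show ?case
    proof (intro allI impI)
      fix s assume s: "\<bar>s\<bar> \<le> T"
      have "norm (oriented_integral s (\<lambda>s. F s (u s)) - oriented_integral s (\<lambda>s. F s (v s)))
          \<le> B * L ^ Suc n * \<bar>s\<bar> ^ Suc n / fact (Suc n)"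
        by (rule picard_step[where T = T and d = "\<lambda>s. norm (u s - v s)"])
           (use L Suc s cont u(1) v(1) in auto)
      then show "norm (u s - v s) \<le> B * L ^ Suc n * \<bar>s\<bar> ^ Suc n / fact (Suc n)"
        by (subst u(2), subst v(2)) simp
    qed
  qed
  then have "norm (u t - v t) \<le> B * (L * \<bar>t\<bar>) ^ n / fact n" for n
    by (simp add: T_def power_mult_distrib mult.assoc)
  then have "norm (u t - v t) \<le> 0"
    by (intro LIMSEQ_le_const[OF exp_terms_tendsto_0]) auto
  then show "u t = v t" by simp
qed

text \<open>The increments of the Picard iterates are dominated on each compact interval by B (L
  T)^n / n!, so the iterates converge uniformly there. The limit is therefore continuous, and
  uniform convergence allows passing to the limit under the integral.\<close>

lemma picard_exists:
  fixes F :: "real \<Rightarrow> 'b::banach \<Rightarrow> 'b"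
  assumes lip: "\<And>T. \<exists>L\<ge>0. \<forall>t u v. \<bar>t\<bar> \<le> T \<longrightarrow> norm (F t u - F t v) \<le> L * norm (u - v)"
    and cont: "\<And>u. continuous_on UNIV u \<Longrightarrow> continuous_on UNIV (\<lambda>t. F t (u t))"
  shows "\<exists>u. continuous_on UNIV u \<and> (\<forall>t. u t = v0 + oriented_integral t (\<lambda>s. F s (u s)))"
proof -
  define P where "P u t = v0 + oriented_integral t (\<lambda>s. F s (u s))" for u t
  define U where "U n = (P ^^ n) (\<lambda>_. v0)" for n
  have U0: "U 0 t = v0" and US: "U (Suc n) t = v0 + oriented_integral t (\<lambda>s. F s (U n s))" for n t
    by (simp_all add: U_def P_def)
  have contU: "continuous_on UNIV (U n)" for n
  proof (induction n)
    case (Suc n)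
    then show ?case
      unfolding US[abs_def] by (intro continuous_intros continuous_on_oriented_integral cont)
  qed (simp add: U_def)
  \<comment> \<open>The limit is written as a telescoping series, so that the Weierstrass test
    applies to the increments and the same formula serves for all \<open>T\<close>.\<close>
  define u where "u t = v0 + (\<Sum>n. U (Suc n) t - U n t)" for t
  have unif: "uniform_limit {-T..T} U u sequentially" for T
  proof -
    obtain L where L: "0 \<le> L" "\<And>t u v. \<bar>t\<bar> \<le> T \<Longrightarrow> norm (F t u - F t v) \<le> L * norm (u - v)"
      using lip[of T] by auto
    have "bounded ((\<lambda>s. U 1 s - U 0 s) ` {-T..T})"
      by (intro compact_imp_bounded compact_continuous_image continuous_intros
          continuous_on_subset[OF contU]) auto
    then obtain B where B: "\<And>s. s \<in> {-T..T} \<Longrightarrow> norm (U 1 s - U 0 s) \<le> B"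
      unfolding bounded_iff by blast
    have est: "\<forall>s. \<bar>s\<bar> \<le> T \<longrightarrow> norm (U (Suc n) s - U n s) \<le> B * L ^ n * \<bar>s\<bar> ^ n / fact n" for n
    proof (induction n)
      case 0
      then show ?case using B by (auto simp: abs_le_iff)
    next
      case (Suc n)
      show ?case
      proof (intro allI impI)
        fix s assume s: "\<bar>s\<bar> \<le> T"
        have "norm (oriented_integral s (\<lambda>s. F s (U (Suc n) s)) - oriented_integral s (\<lambda>s. F s (U n s)))
            \<le> B * L ^ Suc n * \<bar>s\<bar> ^ Suc n / fact (Suc n)"
          by (rule picard_step[where T = T and d = "\<lambda>s. norm (U (Suc n) s - U n s)"])
             (use L Suc s cont contU in auto)
        then show "norm (U (Suc (Suc n)) s - U (Suc n) s) \<le> B * L ^ Suc n * \<bar>s\<bar> ^ Suc n / fact (Suc n)"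
          by (subst US, subst (2) US) simp
      qed
    qed
    have "uniform_limit {-T..T} (\<lambda>n t. \<Sum>i<n. U (Suc i) t - U i t) (\<lambda>t. \<Sum>i. U (Suc i) t - U i t) sequentially"
    proof (rule Weierstrass_m_test)
      fix n s assume s: "s \<in> {-T..T}"
      then have "0 \<le> B" using B[OF s] norm_ge_zero order_trans by blast
      have "norm (U (Suc n) s - U n s) \<le> B * L ^ n * \<bar>s\<bar> ^ n / fact n"
        using est s by (auto simp: abs_le_iff)
      also have "\<dots> \<le> B * L ^ n * \<bar>T\<bar> ^ n / fact n"
        using \<open>0 \<le> B\<close> L s by (intro divide_right_mono mult_left_mono power_mono) auto
      also have "\<dots> = B * (inverse (fact n) * (L * \<bar>T\<bar>) ^ n)"
        by (simp add: field_simps power_mult_distrib)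
      finally show "norm (U (Suc n) s - U n s) \<le> B * (inverse (fact n) * (L * \<bar>T\<bar>) ^ n)" .
    qed (intro summable_mult summable_exp)
    moreover have "(\<Sum>i<n. U (Suc i) t - U i t) = U n t - v0" for n t
      using sum_lessThan_telescope[of "\<lambda>i. U i t" n] by (simp add: U0)
    ultimately have "uniform_limit {-T..T} (\<lambda>n t. U n t - v0) (\<lambda>t. \<Sum>i. U (Suc i) t - U i t) sequentially"
      by simp
    then have "uniform_limit {-T..T} (\<lambda>n t. v0 + (U n t - v0)) u sequentially"
      unfolding u_def by (intro uniform_limit_add uniform_limit_const)
    then show ?thesis by simp
  qed
  have contu: "continuous_on UNIV u"
  proof (rule continuous_at_imp_continuous_on, rule ballI)
    fix t :: real
    \<comment> \<open>The interval is enlarged by 1 so that t is an interior point.\<close>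
    have "continuous_on {-(\<bar>t\<bar>+1)..\<bar>t\<bar>+1} u"
      by (intro uniform_limit_theorem[OF _ unif] always_eventually allI continuous_on_subset[OF contU]) auto
    then show "isCont u t"
      by (rule continuous_on_interior) (auto simp: abs_le_iff)
  qed
  have "u t = v0 + oriented_integral t (\<lambda>s. F s (u s))" for t
  proof (rule LIMSEQ_unique)
    have lim: "(\<lambda>n. U n t) \<longlonglongrightarrow> u t"
      using unif[of "\<bar>t\<bar>"] by (rule tendsto_uniform_limitI) auto
    then show "(\<lambda>n. U (Suc n) t) \<longlonglongrightarrow> u t"
      by (rule LIMSEQ_Suc)
    obtain L where L: "0 \<le> L" "\<And>s u v. \<bar>s\<bar> \<le> \<bar>t\<bar> \<Longrightarrow> norm (F s u - F s v) \<le> L * norm (u - v)"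
      using lip[of "\<bar>t\<bar>"] by auto
    show "(\<lambda>n. U (Suc n) t) \<longlonglongrightarrow> v0 + oriented_integral t (\<lambda>s. F s (u s))"
    proof (rule LIMSEQ_I)
      fix e :: real assume "0 < e"
      \<comment> \<open>The summand 1 keeps \<open>K\<close> positive when L |t| = 0, so
        \<open>d\<close> is well defined; then d L |t| \<le> d K = e / 2.\<close>
      define K where "K = L * \<bar>t\<bar> + 1"
      define d where "d = e / (2 * K)"
      have nz: "0 < K" using L by (simp add: K_def add_nonneg_pos)
      have d: "0 < d" unfolding d_def using \<open>0 < e\<close> nz by (intro divide_pos_pos) auto
      have "eventually (\<lambda>n. \<forall>s\<in>{-\<bar>t\<bar>..\<bar>t\<bar>}. dist (U n s) (u s) < d) sequentially"
        using unif[of "\<bar>t\<bar>"] d unfolding uniform_limit_iff by blast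
      then obtain N where N: "\<And>n s. N \<le> n \<Longrightarrow> s \<in> {-\<bar>t\<bar>..\<bar>t\<bar>} \<Longrightarrow> dist (U n s) (u s) < d"
        unfolding eventually_sequentially by blast
      show "\<exists>N. \<forall>n\<ge>N. norm (U (Suc n) t - (v0 + oriented_integral t (\<lambda>s. F s (u s)))) < e"
      proof (intro exI allI impI)
        fix n assume n: "N \<le> n"
        \<comment> \<open>\<open>picard_step\<close> with exponent 0: the uniform distance
          \<open>d\<close> between the iterate and the limit plays the role of the constant
          bound.\<close>
        have "norm (oriented_integral t (\<lambda>s. F s (U n s)) - oriented_integral t (\<lambda>s. F s (u s)))
            \<le> d * L ^ Suc 0 * \<bar>t\<bar> ^ Suc 0 / fact (Suc 0)"
        proof (rule picard_step[where T = "\<bar>t\<bar>" and d = "\<lambda>s. norm (U n s - u s)"])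
          fix s assume "\<bar>s\<bar> \<le> \<bar>t\<bar>"
          then show "norm (U n s - u s) \<le> d * L ^ 0 * \<bar>s\<bar> ^ 0 / fact 0"
            using N[OF n, of s] by (simp add: abs_le_iff dist_norm)
        qed (use L cont contU contu in auto)
        also have "\<dots> \<le> d * K" using d by (simp add: K_def algebra_simps)
        also have "\<dots> = e / 2" using nz by (simp add: d_def)
        also have "\<dots> < e" using \<open>0 < e\<close> by simp
        finally show "norm (U (Suc n) t - (v0 + oriented_integral t (\<lambda>s. F s (u s)))) < e"
          by (simp add: US)
      qed
    qed
  qed
  with contu show ?thesis by blast
qed

subsection \<open>Multiplication operators\<close>

definition multiplier :: "(real^3 \<Rightarrow> real) \<Rightarrow> bool" where
  "multiplier \<phi> \<longleftrightarrow> \<phi> \<in> borel_measurable borel \<and> bounded (range \<phi>)"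

lemma multiplierI: "\<phi> \<in> borel_measurable borel \<Longrightarrow> (\<And>k. \<bar>\<phi> k\<bar> \<le> B) \<Longrightarrow> multiplier \<phi>"
  by (auto simp: multiplier_def bounded_iff)

lemma multiplier_bound: "multiplier \<phi> \<Longrightarrow> \<exists>B. \<forall>k. \<bar>\<phi> k\<bar> \<le> B"
  by (auto simp: multiplier_def bounded_iff)

lemma transverse_L2_multiplier: "transverse_L2 f \<Longrightarrow> multiplier \<phi> \<Longrightarrow> transverse_L2 (\<lambda>k. \<phi> k *\<^sub>R f k)"
  using multiplier_bound[of \<phi>] by (auto intro: transverse_L2_mult_bounded simp: multiplier_def)

lemma multiplier_const [simp]: "multiplier (\<lambda>k. c)"
  by (simp add: multiplier_def)

lemma multiplier_cos [simp]: "multiplier (\<lambda>k. cos (t * norm k))"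
  by (rule multiplierI[where B = 1]) auto

lemma multiplier_sin [simp]: "multiplier (\<lambda>k. sin (t * norm k))"
  by (rule multiplierI[where B = 1]) auto

lemma multiplier_add [simp]: "multiplier \<phi> \<Longrightarrow> multiplier \<psi> \<Longrightarrow> multiplier (\<lambda>k. \<phi> k + \<psi> k)"
  by (auto simp: multiplier_def intro: bounded_plus_comp)

lemma multiplier_mult [simp]: "multiplier \<phi> \<Longrightarrow> multiplier \<psi> \<Longrightarrow> multiplier (\<lambda>k. \<phi> k * \<psi> k)"
proof -
  assume m: "multiplier \<phi>" "multiplier \<psi>"
  then obtain A B where AB: "\<And>k. \<bar>\<phi> k\<bar> \<le> A" "\<And>k. \<bar>\<psi> k\<bar> \<le> B"
    using multiplier_bound by meson
  have "0 \<le> A" using AB(1)[of 0] by linarith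
  with AB have "\<bar>\<phi> k * \<psi> k\<bar> \<le> A * B" for k
    by (simp add: abs_mult mult_mono)
  with m show ?thesis by (intro multiplierI) (auto simp: multiplier_def)
qed

lemma multiplier_minus [simp]: "multiplier \<phi> \<Longrightarrow> multiplier (\<lambda>k. - \<phi> k)"
  using multiplier_mult[of "\<lambda>_. -1" \<phi>] by simp

lemma multiplier_diff [simp]: "multiplier \<phi> \<Longrightarrow> multiplier \<psi> \<Longrightarrow> multiplier (\<lambda>k. \<phi> k - \<psi> k)"
  using multiplier_add[of \<phi> "\<lambda>k. - \<psi> k"] by simp

text \<open>The value 0 for symbols that are not multipliers makes the map respect
  \<open>hrel\<close> for every symbol, and it keeps linearity and boundedness free of side
  conditions.\<close>

lift_definition mult_op :: "(real^3 \<Rightarrow> real) \<Rightarrow> hfield \<Rightarrow> hfield" is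
  "\<lambda>\<phi> f. if multiplier \<phi> then (\<lambda>k. \<phi> k *\<^sub>R f k) else (\<lambda>k. 0)"
  unfolding hrel_def by (auto simp: transverse_L2_multiplier)

lemmas transverse_L2_intros =
  transverse_L2_add transverse_L2_diff transverse_L2_minus transverse_L2_scale transverse_L2_multiplier

lemma mult_op_add_right: "mult_op \<phi> (f + g) = mult_op \<phi> f + mult_op \<phi> g"
  by transfer (auto simp: hrel_def scaleR_add_right intro!: transverse_L2_intros)

lemma mult_op_scaleR: "mult_op \<phi> (c *\<^sub>R f) = c *\<^sub>R mult_op \<phi> f"
  by transfer (auto simp: hrel_def intro!: transverse_L2_intros)

lemma linear_mult_op: "linear (mult_op \<phi>)"
  by (rule linearI) (simp_all add: mult_op_add_right mult_op_scaleR)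

lemma mult_op_add: "multiplier \<phi> \<Longrightarrow> multiplier \<psi> \<Longrightarrow> mult_op (\<lambda>k. \<phi> k + \<psi> k) f = mult_op \<phi> f + mult_op \<psi> f"
  by transfer (auto simp: hrel_def scaleR_add_left intro!: transverse_L2_intros)

lemma mult_op_diff: "multiplier \<phi> \<Longrightarrow> multiplier \<psi> \<Longrightarrow> mult_op (\<lambda>k. \<phi> k - \<psi> k) f = mult_op \<phi> f - mult_op \<psi> f"
  by transfer (auto simp: hrel_def scaleR_diff_left intro!: transverse_L2_intros)

lemma mult_op_minus: "multiplier \<phi> \<Longrightarrow> mult_op (\<lambda>k. - \<phi> k) f = - mult_op \<phi> f"
  by transfer (auto simp: hrel_def intro!: transverse_L2_intros)

lemma mult_op_const: "mult_op (\<lambda>k. c) f = c *\<^sub>R f"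
  by transfer (auto simp: hrel_def intro!: transverse_L2_intros)

lemma mult_op_mult_op:
  "multiplier \<phi> \<Longrightarrow> multiplier \<psi> \<Longrightarrow> mult_op \<phi> (mult_op \<psi> f) = mult_op (\<lambda>k. \<phi> k * \<psi> k) f"
  by transfer (auto simp: hrel_def intro!: transverse_L2_intros)

lemma mult_op_commute:
  "multiplier \<phi> \<Longrightarrow> multiplier \<psi> \<Longrightarrow> mult_op \<phi> (mult_op \<psi> f) = mult_op \<psi> (mult_op \<phi> f)"
  by (simp add: mult_op_mult_op mult.commute)

lemma mult_op_inner: "mult_op \<phi> f \<bullet> g = f \<bullet> mult_op \<phi> g"
  by transfer (auto intro!: Bochner_Integration.integral_cong)

lemma power2_norm_hfield: "(norm f)\<^sup>2 = (\<integral>k. (norm (rep_hfield f k))\<^sup>2 \<partial>lborel)"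
  using norm_hfield_abs[OF transverse_L2_rep[of f]] by (simp add: abs_rep_hfield)

lemma mult_op_rep:
  "multiplier \<phi> \<Longrightarrow> mult_op \<phi> f = abs_hfield (\<lambda>k. \<phi> k *\<^sub>R rep_hfield f k)"
  using mult_op.abs_eq[of "rep_hfield f" \<phi>] by (simp add: abs_rep_hfield hrel_def transverse_L2_rep)

lemma power2_norm_mult_op:
  assumes "multiplier \<phi>"
  shows "(norm (mult_op \<phi> f))\<^sup>2 = (\<integral>k. (\<phi> k)\<^sup>2 * (norm (rep_hfield f k))\<^sup>2 \<partial>lborel)"
  using norm_hfield_abs[OF transverse_L2_multiplier[OF transverse_L2_rep assms]] assms
  by (simp add: mult_op_rep power_mult_distrib)

lemma integrable_rep: "integrable lborel (\<lambda>k. (norm (rep_hfield f k))\<^sup>2)"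
  using transverse_L2_rep[of f] by (simp add: transverse_L2_def)

lemma rep_measurable [measurable]: "rep_hfield f \<in> borel_measurable borel"
  by (rule transverse_L2_measurable[OF transverse_L2_rep])

lemma norm_mult_op_le:
  assumes "multiplier \<phi>" and B: "\<And>k. \<bar>\<phi> k\<bar> \<le> B"
  shows "norm (mult_op \<phi> f) \<le> B * norm f"
proof (rule power2_le_imp_le)
  have *: "(\<phi> k)\<^sup>2 \<le> B\<^sup>2" for k
    using power_mono[OF B abs_ge_zero, of k 2] by simp
  have [measurable]: "\<phi> \<in> borel_measurable borel" using assms by (simp add: multiplier_def)
  have "(\<integral>k. (\<phi> k)\<^sup>2 * (norm (rep_hfield f k))\<^sup>2 \<partial>lborel) \<le> (\<integral>k. B\<^sup>2 * (norm (rep_hfield f k))\<^sup>2 \<partial>lborel)"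
  proof (rule integral_mono_AE)
    show "integrable lborel (\<lambda>k. B\<^sup>2 * (norm (rep_hfield f k))\<^sup>2)"
      by (intro integrable_mult_right integrable_rep)
    then show "integrable lborel (\<lambda>k. (\<phi> k)\<^sup>2 * (norm (rep_hfield f k))\<^sup>2)"
      by (rule Bochner_Integration.integrable_bound) (auto intro!: AE_I2 mult_right_mono * simp: abs_mult)
  qed (auto intro!: AE_I2 mult_right_mono *)
  then show "(norm (mult_op \<phi> f))\<^sup>2 \<le> (B * norm f)\<^sup>2"
    by (simp add: power2_norm_mult_op assms power_mult_distrib power2_norm_hfield[of f])
  show "0 \<le> B * norm f" using B[of 0] by (intro mult_nonneg_nonneg) auto
qed

lemma bounded_linear_mult_op: "bounded_linear (mult_op \<phi>)"
proof (cases "multiplier \<phi>")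
  case True
  then obtain B where "\<And>k. \<bar>\<phi> k\<bar> \<le> B" using multiplier_bound by blast
  with True show ?thesis
    by (intro bounded_linear_intro[where K = B])
       (auto simp: mult_op_add_right mult_op_scaleR mult.commute intro: norm_mult_op_le)
next
  case False
  then have "mult_op \<phi> f = 0" for f
    by transfer (simp add: hrel_def)
  then have "mult_op \<phi> = (\<lambda>_. 0)" by (rule ext)
  then show ?thesis by simp
qed

text \<open>Dominated convergence with majorant B^2 |f|^2, along sequences that avoid
  \<open>t\<close>. Since \<open>f\<close> is fixed, pointwise convergence of the symbols suffices;
  no uniformity in k is needed.\<close>

lemma mult_op_tendsto_0:
  fixes \<phi> :: "real \<Rightarrow> real^3 \<Rightarrow> real"
  assumes m: "\<And>s. multiplier (\<phi> s)" and B: "\<And>s k. \<bar>\<phi> s k\<bar> \<le> B"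
    and lim: "\<And>k. ((\<lambda>s. \<phi> s k) \<longlongrightarrow> 0) (at t)"
  shows "((\<lambda>s. mult_op (\<phi> s) f) \<longlongrightarrow> 0) (at t)"
proof -
  have [measurable]: "\<phi> s \<in> borel_measurable borel" for s
    using m by (simp add: multiplier_def)
  have "(\<lambda>n. mult_op (\<phi> (S n)) f) \<longlonglongrightarrow> 0" if S: "\<forall>i. S i \<noteq> t" "S \<longlonglongrightarrow> t" for S
  proof -
    have "(\<lambda>n. \<integral>k. (\<phi> (S n) k)\<^sup>2 * (norm (rep_hfield f k))\<^sup>2 \<partial>lborel) \<longlonglongrightarrow> (\<integral>k. 0 \<partial>(lborel :: (real^3) measure))"
    proof (rule Bochner_Integration.integral_dominated_convergence)
      show "integrable lborel (\<lambda>k. B\<^sup>2 * (norm (rep_hfield f k))\<^sup>2)"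
        by (intro integrable_mult_right integrable_rep)
      have "(\<lambda>n. \<phi> (S n) k) \<longlonglongrightarrow> 0" for k
        using lim[of k] S unfolding tendsto_at_iff_sequentially by (auto simp: o_def)
      then have "(\<lambda>n. (\<phi> (S n) k)\<^sup>2 * (norm (rep_hfield f k))\<^sup>2) \<longlonglongrightarrow> 0\<^sup>2 * (norm (rep_hfield f k))\<^sup>2" for k
        by (intro tendsto_intros)
      then show "AE k in lborel. (\<lambda>n. (\<phi> (S n) k)\<^sup>2 * (norm (rep_hfield f k))\<^sup>2) \<longlonglongrightarrow> 0" by simp
      fix n
      show "AE k in lborel. norm ((\<phi> (S n) k)\<^sup>2 * (norm (rep_hfield f k))\<^sup>2) \<le> B\<^sup>2 * (norm (rep_hfield f k))\<^sup>2"
        using power_mono[OF B abs_ge_zero, of "S n" _ 2]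
        by (intro AE_I2) (simp add: abs_mult mult_right_mono)
    qed measurable
    then have "(\<lambda>n. (norm (mult_op (\<phi> (S n)) f))\<^sup>2) \<longlonglongrightarrow> 0"
      by (simp add: power2_norm_mult_op m)
    then have "(\<lambda>n. sqrt ((norm (mult_op (\<phi> (S n)) f))\<^sup>2)) \<longlonglongrightarrow> sqrt 0"
      by (rule tendsto_real_sqrt)
    then show ?thesis by (simp add: tendsto_norm_zero_iff)
  qed
  then show ?thesis unfolding tendsto_at_iff_sequentially by (auto simp: o_def)
qed

subsection \<open>The free flow\<close>

lemma flow_q_eq: "flow_q t q p = mult_op (\<lambda>k. cos (t * norm k)) q + mult_op (\<lambda>k. sin (t * norm k)) p"
  by transfer (auto simp: hrel_def intro!: transverse_L2_intros)

lemma flow_p_eq: "flow_p t q p = mult_op (\<lambda>k. cos (t * norm k)) p - mult_op (\<lambda>k. sin (t * norm k)) q"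
  by transfer (auto simp: hrel_def intro!: transverse_L2_intros)

lemma free_flow_eq:
  "free_flow t X =
     (mult_op (\<lambda>k. cos (t * norm k)) (fst X) + mult_op (\<lambda>k. sin (t * norm k)) (snd X),
      mult_op (\<lambda>k. cos (t * norm k)) (snd X) - mult_op (\<lambda>k. sin (t * norm k)) (fst X))"
  by (simp add: free_flow_def flow_q_eq flow_p_eq)

lemma free_flow_0 [simp]: "free_flow 0 X = X"
  by (simp add: free_flow_eq mult_op_const)

text \<open>The group law is the pair of addition formulas for cos and sin, read as identities
  between multiplication operators.\<close>

lemma free_flow_add: "free_flow s (free_flow t X) = free_flow (s + t) X"
proof -
  have "mult_op (\<lambda>k. cos ((s + t) * norm k)) f
      = mult_op (\<lambda>k. cos (s * norm k)) (mult_op (\<lambda>k. cos (t * norm k)) f)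
        - mult_op (\<lambda>k. sin (s * norm k)) (mult_op (\<lambda>k. sin (t * norm k)) f)"
    "mult_op (\<lambda>k. sin ((s + t) * norm k)) f
      = mult_op (\<lambda>k. sin (s * norm k)) (mult_op (\<lambda>k. cos (t * norm k)) f)
        + mult_op (\<lambda>k. cos (s * norm k)) (mult_op (\<lambda>k. sin (t * norm k)) f)" for f
    by (simp_all add: mult_op_mult_op mult_op_add[symmetric] mult_op_diff[symmetric]
        distrib_right cos_add sin_add)
  then show ?thesis
    by (simp add: free_flow_eq linear_add[OF linear_mult_op] linear_diff[OF linear_mult_op])
qed

lemma free_flow_inject: "free_flow t X = free_flow t Y \<longleftrightarrow> X = Y"
proof
  assume "free_flow t X = free_flow t Y"
  then have "free_flow (- t) (free_flow t X) = free_flow (- t) (free_flow t Y)" by simp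
  then show "X = Y" by (simp add: free_flow_add)
qed simp

lemma linear_free_flow: "linear (free_flow t)"
  by (rule linearI) (simp_all add: free_flow_eq mult_op_add_right mult_op_scaleR algebra_simps)

text \<open>For each k the flow rotates the pair (q(k), p(k)). On the level of operators, the
  diagonal terms combine through cos^2 + sin^2 = 1, and the mixed terms cancel because the two
  multipliers are symmetric and commute.\<close>

lemma norm_free_flow [simp]: "norm (free_flow t X) = norm X"
proof -
  have 1: "mult_op (\<lambda>k. cos (t * norm k)) (mult_op (\<lambda>k. cos (t * norm k)) f)
      + mult_op (\<lambda>k. sin (t * norm k)) (mult_op (\<lambda>k. sin (t * norm k)) f) = f" for f
  proof -
    have "cos (t * norm k) * cos (t * norm k) + sin (t * norm k) * sin (t * norm k) = 1" for k :: "real^3"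
      using sin_cos_squared_add3 by blast
    then show ?thesis
      by (simp add: mult_op_mult_op mult_op_add[symmetric] mult_op_const)
  qed
  have 2: "mult_op (\<lambda>k. cos (t * norm k)) (mult_op (\<lambda>k. sin (t * norm k)) f)
      = mult_op (\<lambda>k. sin (t * norm k)) (mult_op (\<lambda>k. cos (t * norm k)) f)" for f
    by (simp add: mult_op_commute)
  let ?c = "mult_op (\<lambda>k. cos (t * norm k))" and ?s = "mult_op (\<lambda>k. sin (t * norm k))"
  have A: "?c f \<bullet> ?c f + ?s f \<bullet> ?s f = f \<bullet> f" for f
    unfolding mult_op_inner inner_add_right[symmetric] 1 ..
  have B: "?c (fst X) \<bullet> ?s (snd X) = ?c (snd X) \<bullet> ?s (fst X)"
    unfolding inner_commute[of "?c (snd X)"] unfolding mult_op_inner 2 ..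
  have "(f + g) \<bullet> (f + g) = f \<bullet> f + g \<bullet> g + 2 * (f \<bullet> g)" "(f - g) \<bullet> (f - g) = f \<bullet> f + g \<bullet> g - 2 * (f \<bullet> g)"
    for f g :: hfield
    by (simp_all add: inner_simps inner_commute)
  then have "free_flow t X \<bullet> free_flow t X = X \<bullet> X"
    using A[of "fst X"] A[of "snd X"] B
    unfolding free_flow_eq inner_prod_def fst_conv snd_conv by simp
  then show ?thesis by (simp add: norm_eq_sqrt_inner)
qed

lemma bounded_linear_free_flow: "bounded_linear (free_flow t)"
  using linear_free_flow[of t] by (intro bounded_linear_intro[where K = 1])
    (simp_all add: linear_add linear_scale)

lemma mult_op_tendsto:
  fixes \<phi> :: "real \<Rightarrow> real^3 \<Rightarrow> real"
  assumes m: "\<And>s. multiplier (\<phi> s)" and B: "\<And>s k. \<bar>\<phi> s k\<bar> \<le> B"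
    and lim: "\<And>k. ((\<lambda>s. \<phi> s k) \<longlongrightarrow> \<phi> t k) (at t)"
  shows "((\<lambda>s. mult_op (\<phi> s) f) \<longlongrightarrow> mult_op (\<phi> t) f) (at t)"
proof (rule LIM_zero_cancel)
  have "\<bar>\<phi> s k - \<phi> t k\<bar> \<le> B + B" for s k
    using B[of s k] B[of t k] by linarith
  then have "((\<lambda>s. mult_op (\<lambda>k. \<phi> s k - \<phi> t k) f) \<longlongrightarrow> 0) (at t)"
    using lim by (intro mult_op_tendsto_0 multiplier_diff m LIM_zero)
  then show "((\<lambda>s. mult_op (\<phi> s) f - mult_op (\<phi> t) f) \<longlongrightarrow> 0) (at t)"
    by (simp add: mult_op_diff m)
qed

lemma isCont_free_flow: "isCont (\<lambda>s. free_flow s X) t"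
proof -
  have "((\<lambda>s. mult_op (\<lambda>k. cos (s * norm k)) f) \<longlongrightarrow> mult_op (\<lambda>k. cos (t * norm k)) f) (at t)"
    "((\<lambda>s. mult_op (\<lambda>k. sin (s * norm k)) f) \<longlongrightarrow> mult_op (\<lambda>k. sin (t * norm k)) f) (at t)" for f
    by (rule mult_op_tendsto[where B = 1]; auto intro!: tendsto_intros)+
  then show ?thesis
    unfolding isCont_def free_flow_eq by (intro tendsto_intros)
qed

text \<open>Isometry makes the flow equicontinuous: the error \<open>X z - X0\<close> keeps its norm
  under \<open>free_flow (s z)\<close>. Joint continuity thus reduces to continuity in time on the
  single vector \<open>X0\<close>.\<close>

lemma tendsto_free_flow:
  assumes s: "(s \<longlongrightarrow> t) F" and X: "(X \<longlongrightarrow> X0) F"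
  shows "((\<lambda>z. free_flow (s z) (X z)) \<longlongrightarrow> free_flow t X0) F"
proof -
  have "((\<lambda>z. norm (X z - X0)) \<longlongrightarrow> 0) F"
    using X by (intro tendsto_norm_zero LIM_zero)
  then have "((\<lambda>z. norm (free_flow (s z) (X z - X0))) \<longlongrightarrow> 0) F" by simp
  then have "((\<lambda>z. free_flow (s z) (X z - X0)) \<longlongrightarrow> 0) F" by (rule tendsto_norm_zero_cancel)
  moreover have "((\<lambda>z. free_flow (s z) X0) \<longlongrightarrow> free_flow t X0) F"
    by (rule isCont_tendsto_compose[OF isCont_free_flow s])
  ultimately have "((\<lambda>z. free_flow (s z) (X z - X0) + free_flow (s z) X0) \<longlongrightarrow> 0 + free_flow t X0) F"
    by (rule tendsto_add)
  then show ?thesis by (simp add: linear_diff[OF linear_free_flow])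
qed

lemma continuous_on_free_flow [continuous_intros]:
  "continuous_on S s \<Longrightarrow> continuous_on S X \<Longrightarrow> continuous_on S (\<lambda>z. free_flow (s z) (X z))"
  unfolding continuous_on_def by (auto intro: tendsto_free_flow)

section \<open>The resolvent of M and the derivative of the flow on the domain of M\<close>

definition resolvent :: "hfield \<Rightarrow> hfield" where
  "resolvent = mult_op (\<lambda>k. 1 / (1 + norm k))"

text \<open>The bounded operator M (1 + M)^{-1}. Once domain vectors are written as resolvents,
  every occurrence of M becomes this operator.\<close>

definition M_resolvent :: "hfield \<Rightarrow> hfield" where
  "M_resolvent = mult_op (\<lambda>k. norm k / (1 + norm k))"

lemma one_plus_norm_pos: "0 < 1 + norm (k :: real^3)"
  by (simp add: add_pos_nonneg)

lemma multiplier_resolvent [simp]: "multiplier (\<lambda>k. 1 / (1 + norm k))"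
  by (rule multiplierI[where B = 1]) (auto simp: divide_le_eq_1_pos one_plus_norm_pos)

lemma multiplier_M_resolvent [simp]: "multiplier (\<lambda>k. norm k / (1 + norm k))"
  by (rule multiplierI[where B = 1]) (auto simp: divide_le_eq_1_pos one_plus_norm_pos)

lemma norm_resolvent_mult: "norm k *\<^sub>R ((1 / (1 + norm k)) *\<^sub>R v) = (norm k / (1 + norm k)) *\<^sub>R v"
  for v :: "'b::real_vector"
  by simp

lemma integrable_norm_resolvent:
  "transverse_L2 f \<Longrightarrow> integrable lborel (\<lambda>k. (norm (norm k *\<^sub>R ((1 / (1 + norm k)) *\<^sub>R f k)))\<^sup>2)"
  unfolding norm_resolvent_mult using transverse_L2_multiplier[OF _ multiplier_M_resolvent]
  by (simp add: transverse_L2_def)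

lemma resolvent_in_DM: "resolvent f \<in> DM"
  unfolding DM_def resolvent_def mem_Collect_eq
  by transfer (use integrable_norm_resolvent in \<open>simp add: hrel_def\<close>)

lemma M_op_resolvent: "M_op (resolvent f) = M_resolvent f"
  unfolding resolvent_def M_resolvent_def
  by transfer (use integrable_norm_resolvent transverse_L2_multiplier[OF _ multiplier_M_resolvent]
      in \<open>simp add: hrel_def\<close>)

text \<open>The preimage is (1 + |k|) f(k), which is square integrable because f and |k| f both
  are.\<close>

lemma DM_resolvent:
  assumes "f \<in> DM"
  obtains g where "f = resolvent g"
proof -
  let ?f = "rep_hfield f"
  have int: "integrable lborel (\<lambda>k. (norm (norm k *\<^sub>R ?f k))\<^sup>2)"
    using assms by (simp add: DM_def in_DM.rep_eq del: norm_scaleR)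
  have "transverse_L2 (\<lambda>k. ?f k + norm k *\<^sub>R ?f k)"
    by (intro transverse_L2_add transverse_L2_rep transverse_L2_mult int) measurable
  moreover have "(1 / (1 + norm k)) *\<^sub>R (?f k + norm k *\<^sub>R ?f k) = ?f k" for k
  proof -
    have "?f k + norm k *\<^sub>R ?f k = (1 + norm k) *\<^sub>R ?f k" by (simp add: scaleR_add_left)
    then show ?thesis using one_plus_norm_pos[of k] by simp
  qed
  ultimately have "resolvent (abs_hfield (\<lambda>k. ?f k + norm k *\<^sub>R ?f k)) = f"
    unfolding resolvent_def by (subst mult_op.abs_eq) (simp_all add: hrel_def abs_rep_hfield)
  then show ?thesis using that by metis
qed

lemma has_vector_derivative_iff_quotient:
  fixes f :: "real \<Rightarrow> 'a::real_normed_vector"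
  shows "(f has_vector_derivative D) (at t) \<longleftrightarrow> ((\<lambda>s. (f s - f t) /\<^sub>R (s - t)) \<longlongrightarrow> D) (at t)"
proof -
  have "norm ((f s - f t) - (s - t) *\<^sub>R D) / norm (s - t) = norm ((f s - f t) /\<^sub>R (s - t) - D)" if "s \<noteq> t" for s
  proof -
    have "(f s - f t) /\<^sub>R (s - t) - D = ((f s - f t) - (s - t) *\<^sub>R D) /\<^sub>R (s - t)"
      using that by (simp add: scaleR_diff_right)
    then show ?thesis by (simp add: divide_inverse mult.commute)
  qed
  then have "((\<lambda>s. norm ((f s - f t) - (s - t) *\<^sub>R D) / norm (s - t)) \<longlongrightarrow> 0) (at t)
    \<longleftrightarrow> ((\<lambda>s. norm ((f s - f t) /\<^sub>R (s - t) - D)) \<longlongrightarrow> 0) (at t)"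
    by (intro filterlim_cong) (auto simp: eventually_at intro!: exI[of _ 1])
  then show ?thesis
    unfolding has_vector_derivative_def has_derivative_iff_norm
    by (simp add: bounded_linear_scaleR_left tendsto_norm_zero_iff LIM_zero_iff)
qed

text \<open>Covers cos and sin at once. The difference quotient of g(s |k|) in s grows at most like
  |k|, since g is 1-Lipschitz; the factor 1 / (1 + |k|) of the resolvent absorbs this growth, so the
  symbols are uniformly bounded and dominated convergence applies.\<close>

lemma mult_op_has_vector_derivative:
  fixes g g' :: "real \<Rightarrow> real"
  assumes deriv: "\<And>x. (g has_real_derivative g' x) (at x)"
    and g: "\<And>x. \<bar>g x\<bar> \<le> 1" and g': "\<And>x. \<bar>g' x\<bar> \<le> 1" and cont: "continuous_on UNIV g'"
  shows "((\<lambda>s. mult_op (\<lambda>k. g (s * norm k)) (resolvent f)) has_vector_derivative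
           mult_op (\<lambda>k. g' (t * norm k)) (M_resolvent f)) (at t)"
proof -
  have "continuous_on UNIV g"
    using deriv by (intro continuous_at_imp_continuous_on) (auto intro: DERIV_isCont)
  then have meas [measurable]: "g \<in> borel_measurable borel" "g' \<in> borel_measurable borel"
    using cont by (auto intro: borel_measurable_continuous_onI)
  have m: "multiplier (\<lambda>k. g (s * norm k))" "multiplier (\<lambda>k. g' (s * norm k))" for s
    using g g' by (auto intro!: multiplierI)
  have lip: "\<bar>g x - g y\<bar> \<le> \<bar>x - y\<bar>" for x y
    using field_differentiable_bound[of UNIV g g' 1 x y] deriv g' by auto
  \<comment> \<open>The symbol of the difference quotient minus the expected derivative, both with
    the resolvent factor included. At s = t the convention \<open>inverse 0 = 0\<close> leaves only
    the bounded derivative term, so the uniform bound persists.\<close>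
  define \<phi> where "\<phi> s k = inverse (s - t) * ((g (s * norm k) - g (t * norm k)) * (1 / (1 + norm k)))
      - g' (t * norm k) * (norm k / (1 + norm k))" for s and k :: "real^3"
  have "((\<lambda>s. mult_op (\<phi> s) f) \<longlongrightarrow> 0) (at t)"
  proof (rule mult_op_tendsto_0)
    show "multiplier (\<phi> s)" for s
      unfolding \<phi>_def by (intro multiplier_diff multiplier_mult multiplier_const m) simp_all
    fix k :: "real^3"
    show "\<bar>\<phi> s k\<bar> \<le> 2" for s
    proof -
      have aux: "\<bar>a\<bar> \<le> n \<Longrightarrow> \<bar>b\<bar> \<le> n \<Longrightarrow> \<bar>a - b\<bar> \<le> 2 * (1 + n)" for a b n :: real
        by simp
      have "\<bar>inverse (s - t) * (g (s * norm k) - g (t * norm k))\<bar> \<le> norm k"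
      proof (cases "s = t")
        case False
        have "\<bar>g (s * norm k) - g (t * norm k)\<bar> \<le> \<bar>s - t\<bar> * norm k"
          using lip[of "s * norm k" "t * norm k"] unfolding left_diff_distrib[symmetric] abs_mult by simp
        with False show ?thesis
          by (simp add: abs_mult field_simps)
      qed simp
      moreover have "\<bar>g' (t * norm k) * norm k\<bar> \<le> norm k"
        using mult_right_mono[OF g'[of "t * norm k"], of "norm k"] by (simp add: abs_mult)
      ultimately have "\<bar>inverse (s - t) * (g (s * norm k) - g (t * norm k)) - g' (t * norm k) * norm k\<bar> \<le> 2 * (1 + norm k)"
        by (rule aux)
      moreover have "\<phi> s k = (inverse (s - t) * (g (s * norm k) - g (t * norm k)) - g' (t * norm k) * norm k) / (1 + norm k)"
        by (simp add: \<phi>_def diff_divide_distrib[of "_ * _" "_ * _"])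
      ultimately show ?thesis
        using one_plus_norm_pos[of k] by (simp add: pos_divide_le_eq)
    qed
    have "((\<lambda>s. g (s * norm k)) has_real_derivative g' (t * norm k) * norm k) (at t)"
      by (rule DERIV_chain2[OF deriv]) (auto intro!: derivative_eq_intros)
    then have "((\<lambda>s. (g (s * norm k) - g (t * norm k)) / (s - t)) \<longlongrightarrow> g' (t * norm k) * norm k) (at t)"
      by (simp add: has_field_derivative_iff)
    then have "((\<lambda>s. ((g (s * norm k) - g (t * norm k)) / (s - t) - g' (t * norm k) * norm k) * (1 / (1 + norm k))) \<longlongrightarrow> 0) (at t)"
      by (intro tendsto_mult_left_zero LIM_zero)
    then show "((\<lambda>s. \<phi> s k) \<longlongrightarrow> 0) (at t)"
      by (simp add: \<phi>_def divide_inverse algebra_simps)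
  qed
  moreover have "mult_op (\<phi> s) f = (mult_op (\<lambda>k. g (s * norm k)) (resolvent f)
      - mult_op (\<lambda>k. g (t * norm k)) (resolvent f)) /\<^sub>R (s - t) - mult_op (\<lambda>k. g' (t * norm k)) (M_resolvent f)" for s
    unfolding \<phi>_def resolvent_def M_resolvent_def
    by (simp only: mult_op_diff mult_op_mult_op[symmetric] mult_op_const m multiplier_mult multiplier_diff multiplier_const
        multiplier_resolvent multiplier_M_resolvent)
  ultimately show ?thesis
    unfolding has_vector_derivative_iff_quotient by (simp add: LIM_zero_iff)
qed

text \<open>The generator of the flow is (q, p) -> (M p, - M q); on resolvent vectors it takes the
  form stated here, which involves bounded operators only.\<close>

lemma free_flow_has_vector_derivative:
  "((\<lambda>s. free_flow s (resolvent f, resolvent g)) has_vector_derivative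
     free_flow t (M_resolvent g, - M_resolvent f)) (at t)"
proof -
  have c: "((\<lambda>s. mult_op (\<lambda>k. cos (s * norm k)) (resolvent f)) has_vector_derivative
      - mult_op (\<lambda>k. sin (t * norm k)) (M_resolvent f)) (at t)" for f
    using mult_op_has_vector_derivative[of cos "\<lambda>x. - sin x" f t]
    by (simp add: mult_op_minus continuous_intros)
  have s: "((\<lambda>s. mult_op (\<lambda>k. sin (s * norm k)) (resolvent f)) has_vector_derivative
      mult_op (\<lambda>k. cos (t * norm k)) (M_resolvent f)) (at t)" for f
    using mult_op_has_vector_derivative[of sin cos f t] by (simp add: continuous_intros)
  show ?thesis
    unfolding free_flow_eq fst_conv snd_conv
    by (rule has_vector_derivative_eq_rhs[OF has_vector_derivative_Pair])
       (rule has_vector_derivative_add has_vector_derivative_diff c s refl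
         | simp add: linear_neg[OF linear_mult_op])+
qed

lemma free_flow_product_derivative:
  assumes W: "(W has_vector_derivative W') (at t)"
    and R: "((\<lambda>s. free_flow s (W t)) has_vector_derivative D) (at t)"
  shows "((\<lambda>s. free_flow s (W s)) has_vector_derivative D + free_flow t W') (at t)"
  unfolding has_vector_derivative_iff_quotient
proof -
  have "((\<lambda>s. (free_flow s (W t) - free_flow t (W t)) /\<^sub>R (s - t) + free_flow s ((W s - W t) /\<^sub>R (s - t)))
      \<longlongrightarrow> D + free_flow t W') (at t)"
    using W R unfolding has_vector_derivative_iff_quotient
    by (intro tendsto_add tendsto_free_flow tendsto_ident_at)
  then show "((\<lambda>s. (free_flow s (W s) - free_flow t (W t)) /\<^sub>R (s - t)) \<longlongrightarrow> D + free_flow t W') (at t)"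
    by (simp add: linear_diff[OF linear_free_flow] linear_scale[OF linear_free_flow] algebra_simps)
qed

subsection \<open>The coadjoint action\<close>

text \<open>Riesz representation is pulled back along an isometric embedding into a Euclidean space,
  so that no orthonormal basis of the domain has to be chosen.\<close>

lemma riesz_representation_embedded:
  fixes f :: "'a::real_inner \<Rightarrow> 'b::euclidean_space" and \<phi> :: "'a \<Rightarrow> real"
  assumes f: "linear f" "\<And>x y. f x \<bullet> f y = x \<bullet> y" and \<phi>: "linear \<phi>"
  shows "\<exists>w. \<forall>x. \<phi> x = w \<bullet> x"
proof -
  have "inj f"
  proof (rule injI)
    fix x y assume "f x = f y"
    then have "f (x - y) \<bullet> f (x - y) = 0" by (simp add: linear_diff[OF f(1)])
    then show "x = y" by (simp add: f(2))
  qed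
  then obtain g where g: "linear g" "g \<circ> f = id"
    using linear_injective_left_inverse[OF f(1)] by blast
  have lin: "linear (\<phi> \<circ> g)" by (rule linear_compose[OF g(1) \<phi>])
  \<comment> \<open>With the left inverse \<open>g\<close> of the embedding,
    \<open>\<phi> \<circ> g\<close> extends \<open>\<phi>\<close> to the whole Euclidean space;
    \<open>v\<close> represents this extension.\<close>
  define v where "v = (\<Sum>b\<in>Basis. (\<phi> \<circ> g) b *\<^sub>R b)"
  have v: "(\<phi> \<circ> g) y = v \<bullet> y" for y
  proof -
    have "(\<phi> \<circ> g) y = (\<phi> \<circ> g) (\<Sum>b\<in>Basis. (y \<bullet> b) *\<^sub>R b)"
      by (simp only: euclidean_representation)
    also have "\<dots> = (\<Sum>b\<in>Basis. (y \<bullet> b) * (\<phi> \<circ> g) b)"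
      by (simp only: linear_sum[OF lin] linear_scale[OF lin] real_scaleR_def)
    also have "\<dots> = v \<bullet> y"
      unfolding v_def inner_sum_left inner_scaleR_left by (simp add: inner_commute mult.commute)
    finally show ?thesis .
  qed
  \<comment> \<open>The representing vector need not lie in the range of \<open>f\<close>. Its
    component orthogonal to the range does not affect values on the range and is dropped.\<close>
  obtain a z where az: "a \<in> span (range f)" "\<And>u. u \<in> span (range f) \<Longrightarrow> orthogonal z u" "v = a + z"
    using orthogonal_subspace_decomp_exists[of "range f" v] by metis
  have "span (range f) = range f"
    using linear_subspace_image[OF f(1), of UNIV] by (simp add: span_eq_iff)
  with az obtain w where w: "a = f w" by auto
  have "\<phi> x = w \<bullet> x" for x
  proof -
    have "\<phi> x = (\<phi> \<circ> g) (f x)" using fun_cong[OF g(2), of x] by simp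
    also have "\<dots> = f w \<bullet> f x + z \<bullet> f x" by (simp only: v az(3) w inner_add_left)
    also have "z \<bullet> f x = 0" using az(2)[of "f x"] by (simp add: span_base orthogonal_def)
    finally show ?thesis by (simp add: f(2))
  qed
  then show ?thesis by blast
qed

lemma linear_Rep_su: "linear Rep_su"
  by (rule linearI) (simp_all add: plus_su.rep_eq scaleR_su.rep_eq)

lemma inner_su_eq_inner: "X \<bullet> Y = Rep_su X \<bullet> Rep_su Y"
proof transfer
  fix X Y :: "complex^'a^'a"
  assume "dagger X = - X \<and> trace X = 0"
  then have "- trace (X ** Y) = (\<Sum>i\<in>UNIV. \<Sum>j\<in>UNIV. cnj (X $ i $ j) * Y $ i $ j)"
    by (intro trace_mult_antihermitian) simp
  from arg_cong[OF this, of Re] show "- Re (trace (X ** Y)) = X \<bullet> Y"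
    by (simp add: inner_vec_def inner_complex_def)
qed

lemma norm_su_eq_norm: "norm X = norm (Rep_su X)"
  by (simp add: norm_eq_sqrt_inner inner_su_eq_inner)

definition riesz :: "('i::finite su \<Rightarrow>\<^sub>L real) \<Rightarrow> 'i su" where
  "riesz \<omega> = (SOME w. \<forall>Y. blinfun_apply \<omega> Y = w \<bullet> Y)"

lemma riesz_inner: "riesz \<omega> \<bullet> Y = blinfun_apply \<omega> Y"
proof -
  have "\<exists>w. \<forall>Y. blinfun_apply \<omega> Y = w \<bullet> Y"
    by (rule riesz_representation_embedded[OF linear_Rep_su inner_su_eq_inner[symmetric]])
       (rule bounded_linear.linear[OF blinfun.bounded_linear_right])
  from someI_ex[OF this] show ?thesis unfolding riesz_def by metis
qed

lemma riesz_eqI: "(\<And>Y. w \<bullet> Y = blinfun_apply \<omega> Y) \<Longrightarrow> riesz \<omega> = w"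
proof -
  assume "\<And>Y. w \<bullet> Y = blinfun_apply \<omega> Y"
  then have "(riesz \<omega> - w) \<bullet> (riesz \<omega> - w) = 0" by (simp only: inner_diff_left riesz_inner)
  then show ?thesis by simp
qed

text \<open>One inequality is Cauchy-Schwarz, the other evaluates the functional at its own
  representative. Hence the operator norm on the dual is the Euclidean norm induced by the trace
  form.\<close>

lemma norm_riesz: "norm (riesz \<omega>) = norm \<omega>"
proof (rule antisym)
  show "norm \<omega> \<le> norm (riesz \<omega>)"
    using Cauchy_Schwarz_ineq2[of "riesz \<omega>"] by (intro norm_blinfun_bound) (simp_all add: riesz_inner)
  have "(norm (riesz \<omega>))\<^sup>2 \<le> norm \<omega> * norm (riesz \<omega>)"
    using norm_blinfun[of \<omega> "riesz \<omega>"] by (simp add: power2_norm_eq_inner riesz_inner)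
  then show "norm (riesz \<omega>) \<le> norm \<omega>"
    by (cases "riesz \<omega> = 0") (simp_all add: power2_eq_square)
qed

lemma bounded_linear_riesz: "bounded_linear riesz"
proof (rule bounded_linear_intro[where K = 1])
  show "riesz (\<omega> + \<eta>) = riesz \<omega> + riesz \<eta>" for \<omega> \<eta> :: "'a su \<Rightarrow>\<^sub>L real"
    by (rule riesz_eqI) (simp add: blinfun.add_left inner_add_left riesz_inner)
  show "riesz (c *\<^sub>R \<omega>) = c *\<^sub>R riesz \<omega>" for c and \<omega> :: "'a su \<Rightarrow>\<^sub>L real"
    by (rule riesz_eqI) (simp add: blinfun.scaleR_left riesz_inner)
qed (simp add: norm_riesz)

text \<open>The commutator is bilinear on a finite-dimensional matrix space, hence bounded there;
  the bound carries over because \<open>Rep_su\<close> preserves the norm.\<close>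

lemma bounded_bilinear_su_bracket: "bounded_bilinear su_bracket"
proof -
  have "bilinear (\<lambda>(X::complex^'a^'a) Y. X ** Y - Y ** X)"
    unfolding bilinear_def
    by (auto intro!: linearI simp: matrix_matrix_mult_def vec_eq_iff sum.distrib algebra_simps
        scaleR_sum_right)
  then have "bounded_bilinear (\<lambda>(X::complex^'a^'a) Y. X ** Y - Y ** X)"
    by (simp add: bilinear_conv_bounded_bilinear)
  then interpret m: bounded_bilinear "\<lambda>(X::complex^'a^'a) Y. X ** Y - Y ** X" .
  obtain K where "\<And>X Y :: complex^'a^'a. norm (X ** Y - Y ** X) \<le> norm X * norm Y * K"
    using m.bounded by blast
  then have K: "norm (su_bracket X Y) \<le> norm X * norm Y * K" for X Y :: "'a su"
    by (simp add: norm_su_eq_norm su_bracket.rep_eq)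
  show ?thesis
  proof
    show "\<exists>K. \<forall>X Y :: 'a su. norm (su_bracket X Y) \<le> norm X * norm Y * K" using K by blast
  qed (simp_all add: Rep_su_inject[symmetric] su_bracket.rep_eq plus_su.rep_eq scaleR_su.rep_eq
      m.add_left m.add_right m.scaleR_left m.scaleR_right)
qed

text \<open>Cyclicity of the trace gives Tr(Y Y X) = Tr(Y X Y). This invariance of the trace form is
  the source of the conservation of |\<omega>|.\<close>

lemma inner_su_bracket_self: "Y \<bullet> su_bracket X Y = 0"
proof transfer
  fix X Y :: "complex^'a^'a"
  have "trace (Y ** (X ** Y - Y ** X)) = trace (Y ** (X ** Y)) - trace (Y ** (Y ** X))"
  proof -
    have "Y ** (A - B) = Y ** A - Y ** B" for A B :: "complex^'a^'a"
      by (simp add: matrix_matrix_mult_def vec_eq_iff right_diff_distrib sum_subtractf)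
    then show ?thesis by (simp add: trace_sub)
  qed
  also have "trace (Y ** (Y ** X)) = trace ((Y ** X) ** Y)" by (rule trace_mul_sym)
  also have "\<dots> = trace (Y ** (X ** Y))" by (simp only: matrix_mul_assoc)
  finally show "- Re (trace (Y ** (X ** Y - Y ** X))) = 0" by simp
qed

text \<open>The coadjoint action up to the sign of the usual convention. With this sign the spin
  equation reads \<omega>' = \<open>coad\<close> \<omega> A for a suitable Lie algebra element
  A.\<close>

definition coad :: "('i::finite su \<Rightarrow>\<^sub>L real) \<Rightarrow> 'i su \<Rightarrow> ('i su \<Rightarrow>\<^sub>L real)" where
  "coad \<omega> X = Blinfun (\<lambda>Y. blinfun_apply \<omega> (su_bracket X Y))"

lemma coad_apply: "blinfun_apply (coad \<omega> X) Y = blinfun_apply \<omega> (su_bracket X Y)"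
proof -
  have "bounded_linear (\<lambda>Y. blinfun_apply \<omega> (su_bracket X Y))"
    using bounded_linear_compose[OF blinfun.bounded_linear_right
        bounded_bilinear.bounded_linear_right[OF bounded_bilinear_su_bracket]] .
  then show ?thesis by (simp add: coad_def bounded_linear_Blinfun_apply)
qed

lemma bounded_bilinear_coad: "bounded_bilinear coad"
proof -
  interpret b: bounded_bilinear su_bracket by (rule bounded_bilinear_su_bracket)
  obtain K where K: "0 < K" "\<And>X Y :: 'a su. norm (su_bracket X Y) \<le> norm X * norm Y * K"
    using b.pos_bounded by blast
  have "norm (coad \<omega> X) \<le> norm \<omega> * norm X * K" for \<omega> and X :: "'a su"
  proof (rule norm_blinfun_bound)
    fix Y
    have "norm (blinfun_apply (coad \<omega> X) Y) \<le> norm \<omega> * norm (su_bracket X Y)"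
      unfolding coad_apply by (rule norm_blinfun)
    also have "\<dots> \<le> norm \<omega> * (norm X * norm Y * K)"
      by (intro mult_left_mono K) simp
    finally show "norm (blinfun_apply (coad \<omega> X) Y) \<le> norm \<omega> * norm X * K * norm Y"
      by (simp add: mult_ac)
  qed (use K in simp)
  then show ?thesis
    by unfold_locales
       (auto intro!: blinfun_eqI simp: coad_apply blinfun.bilinear_simps b.add_left b.scaleR_left)
qed

text \<open>With w = \<open>riesz\<close> \<omega>, the derivative of w \<bullet> w is twice w
  \<bullet> [A, w], which vanishes. Since \<open>A\<close> is an arbitrary function of time, the
  same argument serves the original and the truncated equation.\<close>

lemma coad_norm_conserved:
  assumes deriv: "\<And>t. (\<omega> has_vector_derivative coad (\<omega> t) (A t)) (at t)"
  shows "norm (\<omega> t) = norm (\<omega> 0)"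
proof -
  have "((\<lambda>t. riesz (\<omega> t)) has_vector_derivative riesz (coad (\<omega> t) (A t))) (at t)" for t
    by (rule bounded_linear.has_vector_derivative[OF bounded_linear_riesz deriv])
  then have "((\<lambda>t. riesz (\<omega> t) \<bullet> riesz (\<omega> t)) has_vector_derivative
      (riesz (\<omega> t) \<bullet> riesz (coad (\<omega> t) (A t)) + riesz (coad (\<omega> t) (A t)) \<bullet> riesz (\<omega> t))) (at t)" for t
    by (intro bounded_bilinear.has_vector_derivative[OF bounded_bilinear_inner])
  moreover have "riesz (coad (\<omega> t) (A t)) \<bullet> riesz (\<omega> t) = 0" for t
    by (simp add: riesz_inner coad_apply) (simp add: inner_su_bracket_self flip: riesz_inner)
  ultimately have "((\<lambda>t. riesz (\<omega> t) \<bullet> riesz (\<omega> t)) has_real_derivative 0) (at t)" for t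
    by (simp add: inner_commute has_real_derivative_iff_has_vector_derivative)
  then have "riesz (\<omega> t) \<bullet> riesz (\<omega> t) = riesz (\<omega> 0) \<bullet> riesz (\<omega> 0)"
    by (intro DERIV_isconst_all[of "\<lambda>t. riesz (\<omega> t) \<bullet> riesz (\<omega> t)"]) simp
  then show ?thesis unfolding norm_riesz[symmetric] norm_eq_sqrt_inner by simp
qed

subsection \<open>The interaction picture\<close>

text \<open>The \<open>max\<close> merges the identity on the ball and the projection outside it
  into one formula. The result is always a scalar multiple of the argument; this is what preserves
  the coadjoint structure of the truncated spin equation.\<close>

definition radial_retract :: "real \<Rightarrow> 'a::real_normed_vector \<Rightarrow> 'a" where
  "radial_retract \<kappa> u = (\<kappa> / max \<kappa> (norm u)) *\<^sub>R u"

lemma radial_retract_id: "0 < \<kappa> \<Longrightarrow> norm u \<le> \<kappa> \<Longrightarrow> radial_retract \<kappa> u = u"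
  by (simp add: radial_retract_def max_def)

lemma norm_radial_retract_le:
  assumes "0 < \<kappa>"
  shows "norm (radial_retract \<kappa> u) \<le> \<kappa>" "norm (radial_retract \<kappa> u) \<le> norm u"
proof -
  have m: "0 < max \<kappa> (norm u)" using assms by simp
  have "\<kappa> * norm u \<le> \<kappa> * max \<kappa> (norm u)" "\<kappa> * norm u \<le> norm u * max \<kappa> (norm u)"
    using assms by (auto simp: mult.commute[of \<kappa>] intro: mult_left_mono)
  then show "norm (radial_retract \<kappa> u) \<le> \<kappa>" "norm (radial_retract \<kappa> u) \<le> norm u"
    using assms m by (simp_all add: radial_retract_def pos_divide_le_eq)
qed

text \<open>The difference is split into a part with the common factor \<kappa> / mu, which is at
  most 1, and a part coming from the change of that factor. The latter is controlled because r ->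
  max \<kappa> r is 1-Lipschitz. The two parts give the constant 2 in any normed space.\<close>

lemma norm_radial_retract_diff_le:
  assumes \<kappa>: "0 < \<kappa>"
  shows "norm (radial_retract \<kappa> u - radial_retract \<kappa> v) \<le> 2 * norm (u - v)"
proof -
  define mu mv where "mu = max \<kappa> (norm u)" and "mv = max \<kappa> (norm v)"
  have m: "\<kappa> \<le> mu" "\<kappa> \<le> mv" "norm v \<le> mv" by (auto simp: mu_def mv_def)
  with \<kappa> have pos: "0 < mu" "0 < mv" by auto
  have "\<bar>mv - mu\<bar> \<le> \<bar>norm u - norm v\<bar>" unfolding mu_def mv_def by linarith
  also have "\<dots> \<le> norm (u - v)" by (rule norm_triangle_ineq3)
  finally have d: "\<bar>mv - mu\<bar> \<le> norm (u - v)" .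
  have "radial_retract \<kappa> u - radial_retract \<kappa> v = (\<kappa> / mu) *\<^sub>R (u - v) + ((mv - mu) * (\<kappa> / mu) / mv) *\<^sub>R v"
    using pos unfolding radial_retract_def mu_def[symmetric] mv_def[symmetric]
    by (simp add: algebra_simps diff_divide_distrib)
  also have "norm \<dots> \<le> norm ((\<kappa> / mu) *\<^sub>R (u - v)) + norm (((mv - mu) * (\<kappa> / mu) / mv) *\<^sub>R v)"
    by (rule norm_triangle_ineq)
  also have "\<dots> = (\<kappa> / mu) * norm (u - v) + \<bar>mv - mu\<bar> * (\<kappa> / mu) * (norm v / mv)"
    using pos \<kappa> by (simp add: abs_mult)
  also have "\<dots> \<le> 1 * norm (u - v) + norm (u - v) * 1 * 1"
    using pos \<kappa> m d by (intro add_mono mult_mono) (auto simp: divide_le_eq_1)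
  finally show ?thesis by simp
qed

lemma continuous_on_radial_retract:
  assumes "continuous_on S k" "continuous_on S f" "\<And>t. t \<in> S \<Longrightarrow> 0 < k t"
  shows "continuous_on S (\<lambda>t. radial_retract (k t) (f t))"
proof -
  have "max (k t) (norm (f t)) \<noteq> 0" if "t \<in> S" for t
    using assms(3)[OF that] by (auto simp: max_def)
  then show ?thesis
    unfolding radial_retract_def by (intro continuous_intros assms(1,2)) auto
qed

section \<open>The vector field and its interaction picture\<close>

definition source :: "real \<Rightarrow> (real \<Rightarrow> real) \<Rightarrow> ('n::finite \<Rightarrow> real^3) \<Rightarrow> 'n su_dual \<Rightarrow> hfield \<times> hfield" where
  "source h chi x \<omega> = (source_q h chi x \<omega>, source_p h chi x \<omega>)"

definition spin_field ::
  "(real \<Rightarrow> real) \<Rightarrow> real^3 \<Rightarrow> ('n::finite \<Rightarrow> real^3) \<Rightarrow> hfield \<times> hfield \<Rightarrow> ('n \<Rightarrow> 2) su" where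
  "spin_field chi \<beta> x X = (\<Sum>l\<in>UNIV. \<Sum>m\<in>UNIV. (\<beta> $ m + B_form chi m (x l) X) *\<^sub>R i_sigma m l)"

lemma bounded_linear_source: "bounded_linear (source h chi x)"
proof -
  have "bounded_linear (\<lambda>\<omega>. \<Sum>l\<in>UNIV. \<Sum>m\<in>UNIV. blinfun_apply \<omega> (i_sigma m l) *\<^sub>R f m (x l))"
    for f :: "3 \<Rightarrow> real^3 \<Rightarrow> hfield"
    by (intro bounded_linear_sum bounded_linear_compose[OF bounded_linear_scaleR_left blinfun.bounded_linear_left])
  then show ?thesis
    unfolding source_def[abs_def] source_q_def source_p_def
    by (intro bounded_linear_Pair bounded_linear_minus bounded_linear_compose[OF bounded_linear_scaleR_right])
qed

text \<open>The spin field is affine in the field variables; putting \<open>0\<close> for \<beta>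
  leaves exactly its linear part.\<close>

lemma spin_field_diff:
  "spin_field chi \<beta> x X - spin_field chi \<beta> x Y = spin_field chi 0 x (X - Y)"
  unfolding spin_field_def sum_subtractf[symmetric] scaleR_diff_left[symmetric]
  by (intro sum.cong refl arg_cong2[where f = scaleR]) (simp add: B_form_def inner_diff_right)

lemma bounded_linear_spin_field_0: "bounded_linear (spin_field chi 0 x)"
proof -
  have "bounded_linear (B_form chi m y)" for m y
    unfolding B_form_def[abs_def]
    by (intro bounded_linear_add bounded_linear_compose[OF bounded_linear_inner_right]
        bounded_linear_fst bounded_linear_snd)
  then show ?thesis
    unfolding spin_field_def[abs_def]
    by (intro bounded_linear_sum bounded_linear_compose[OF bounded_linear_scaleR_left]) simp
qed

lemma spin_field_eq: "spin_field chi \<beta> x X = spin_field chi \<beta> x 0 + spin_field chi 0 x X"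
  using spin_field_diff[of chi \<beta> x X 0] by (simp add: diff_eq_eq add.commute)

lemma continuous_on_spin_field: "continuous_on S f \<Longrightarrow> continuous_on S (\<lambda>t. spin_field chi \<beta> x (f t))"
  by (subst spin_field_eq)
     (intro continuous_intros bounded_linear.continuous_on[OF bounded_linear_spin_field_0])

lemma coad_spin_field_apply:
  "blinfun_apply (coad (snd u) (spin_field chi \<beta> x (fst u))) Y
     = (\<Sum>l\<in>UNIV. \<Sum>m\<in>UNIV. spin_term chi \<beta> x u Y l m)"
  unfolding coad_apply spin_field_def spin_term_def
    bounded_bilinear.sum_left[OF bounded_bilinear_su_bracket]
    bounded_bilinear.scaleR_left[OF bounded_bilinear_su_bracket]
    blinfun.sum_right blinfun.scaleR_right real_scaleR_def ..

definition rhs ::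
  "real \<Rightarrow> (real \<Rightarrow> real) \<Rightarrow> real^3 \<Rightarrow> ('n::finite \<Rightarrow> real^3) \<Rightarrow> real \<Rightarrow> 'n state \<Rightarrow> 'n state" where
  "rhs h chi \<beta> x t v =
     (free_flow (- t) (source h chi x (snd v)), coad (snd v) (spin_field chi \<beta> x (free_flow t (fst v))))"

definition to_interaction :: "(real \<Rightarrow> 'n::finite state) \<Rightarrow> real \<Rightarrow> 'n state" where
  "to_interaction u t = (free_flow (- t) (fst (u t)), snd (u t))"

definition from_interaction :: "(real \<Rightarrow> 'n::finite state) \<Rightarrow> real \<Rightarrow> 'n state" where
  "from_interaction v t = (free_flow t (fst (v t)), snd (v t))"

lemma from_to_interaction: "from_interaction (to_interaction u) = u"
  by (simp add: from_interaction_def to_interaction_def fun_eq_iff free_flow_add)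

lemma to_from_interaction: "to_interaction (from_interaction v) = v"
  by (simp add: from_interaction_def to_interaction_def fun_eq_iff free_flow_add)

lemma continuous_on_to_interaction: "continuous_on S u \<Longrightarrow> continuous_on S (to_interaction u)"
  unfolding to_interaction_def[abs_def] by (intro continuous_intros)

lemma continuous_on_from_interaction: "continuous_on S v \<Longrightarrow> continuous_on S (from_interaction v)"
  unfolding from_interaction_def[abs_def] by (intro continuous_intros)

lemma continuous_on_rhs:
  "continuous_on S v \<Longrightarrow> continuous_on S (\<lambda>t. rhs h chi \<beta> x t (v t))"
  unfolding rhs_def
  by (intro continuous_intros bounded_linear.continuous_on[OF bounded_linear_source]
      bounded_bilinear.continuous_on[OF bounded_bilinear_coad] continuous_on_spin_field)

lemma oriented_integral_Pair:
  fixes f :: "real \<Rightarrow> 'a::banach" and g :: "real \<Rightarrow> 'b::banach"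
  assumes "continuous_on UNIV f" "continuous_on UNIV g"
  shows "oriented_integral t (\<lambda>s. (f s, g s)) = (oriented_integral t f, oriented_integral t g)"
proof -
  have c: "continuous_on UNIV (\<lambda>s. (f s, g s))" by (intro continuous_intros assms)
  show ?thesis
    using oriented_integral_linear[OF bounded_linear_fst c, of t]
      oriented_integral_linear[OF bounded_linear_snd c, of t] by (simp add: prod_eq_iff)
qed

text \<open>For the field part, R_{t-s} = R_t R_{-s}, the bounded operator R_t is pulled out of the
  integral, and injectivity of R_t removes it. For the spin part, the finite sums and the evaluation
  at Y commute with the integral, so the scalar equations for all Y amount to one equation in the
  dual space.\<close>

lemma weak_solution_iff_interaction:
  fixes u :: "real \<Rightarrow> 'n::finite state"
  defines "v \<equiv> to_interaction u"
  shows "weak_solution h chi \<beta> x u \<longleftrightarrow>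
    continuous_on UNIV v \<and> (\<forall>t. v t = u 0 + oriented_integral t (\<lambda>s. rhs h chi \<beta> x s (v s)))"
proof -
  have cont: "continuous_on UNIV u \<longleftrightarrow> continuous_on UNIV v"
    unfolding v_def using continuous_on_to_interaction continuous_on_from_interaction from_to_interaction by metis
  have u: "fst (u t) = free_flow t (fst (v t))" "snd (u t) = snd (v t)" for t
    by (simp_all add: v_def to_interaction_def free_flow_add)
  show ?thesis
  proof (cases "continuous_on UNIV u")
    case True
    note [continuous_intros] = bounded_linear.continuous_on[OF bounded_linear_source]
      bounded_bilinear.continuous_on[OF bounded_bilinear_coad] continuous_on_spin_field
    have cv: "continuous_on UNIV v" using True cont by simp
    have rhs: "oriented_integral t (\<lambda>s. rhs h chi \<beta> x s (v s)) =
        (oriented_integral t (\<lambda>s. free_flow (- s) (source h chi x (snd (u s)))),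
         oriented_integral t (\<lambda>s. coad (snd (u s)) (spin_field chi \<beta> x (fst (u s)))))" for t
      unfolding rhs_def u by (intro oriented_integral_Pair continuous_intros cv)
    have A: "fst (u t) = free_flow t (fst (u 0)) + oriented_integral t
          (\<lambda>s. free_flow (t - s) (source_q h chi x (snd (u s)), source_p h chi x (snd (u s))))
        \<longleftrightarrow> fst (v t) = fst (u 0) + oriented_integral t (\<lambda>s. free_flow (- s) (source h chi x (snd (u s))))" for t
    proof -
      have "oriented_integral t (\<lambda>s. free_flow (t - s) (source_q h chi x (snd (u s)), source_p h chi x (snd (u s))))
          = oriented_integral t (\<lambda>s. free_flow t (free_flow (- s) (source h chi x (snd (u s)))))"
        by (simp add: free_flow_add source_def)
      also have "\<dots> = free_flow t (oriented_integral t (\<lambda>s. free_flow (- s) (source h chi x (snd (u s)))))"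
        by (intro oriented_integral_linear bounded_linear_free_flow continuous_intros True)
      finally show ?thesis
        unfolding u(1)[of t] by (simp add: linear_add[OF linear_free_flow, symmetric] free_flow_inject)
    qed
    have B: "(\<forall>Y. blinfun_apply (snd (u t)) Y = blinfun_apply (snd (u 0)) Y +
        (\<Sum>l\<in>UNIV. \<Sum>m\<in>UNIV. oriented_integral t (\<lambda>s. spin_term chi \<beta> x (u s) Y l m)))
      \<longleftrightarrow> snd (v t) = snd (u 0) + oriented_integral t (\<lambda>s. coad (snd (u s)) (spin_field chi \<beta> x (fst (u s))))" for t
    proof -
      have "(\<Sum>l\<in>UNIV. \<Sum>m\<in>UNIV. oriented_integral t (\<lambda>s. spin_term chi \<beta> x (u s) Y l m))
          = blinfun_apply (oriented_integral t (\<lambda>s. coad (snd (u s)) (spin_field chi \<beta> x (fst (u s))))) Y" for Y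
      proof -
        have c: "continuous_on UNIV (\<lambda>s. spin_term chi \<beta> x (u s) Y l m)" for l m
          unfolding spin_term_def B_form_def by (intro continuous_intros True)
        have "(\<Sum>l\<in>UNIV. \<Sum>m\<in>UNIV. oriented_integral t (\<lambda>s. spin_term chi \<beta> x (u s) Y l m))
            = oriented_integral t (\<lambda>s. \<Sum>l\<in>UNIV. \<Sum>m\<in>UNIV. spin_term chi \<beta> x (u s) Y l m)"
          by (simp add: oriented_integral_sum continuous_on_sum c)
        also have "\<dots> = oriented_integral t (\<lambda>s. blinfun_apply (coad (snd (u s)) (spin_field chi \<beta> x (fst (u s)))) Y)"
          by (simp add: coad_spin_field_apply)
        also have "\<dots> = blinfun_apply (oriented_integral t (\<lambda>s. coad (snd (u s)) (spin_field chi \<beta> x (fst (u s))))) Y"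
          by (intro oriented_integral_linear blinfun.bounded_linear_left continuous_intros True)
        finally show ?thesis .
      qed
      then show ?thesis
        unfolding u(2)[symmetric] by (auto simp: blinfun.add_left intro!: blinfun_eqI)
    qed
    have "weak_solution h chi \<beta> x u \<longleftrightarrow>
        (\<forall>t. fst (v t) = fst (u 0) + oriented_integral t (\<lambda>s. free_flow (- s) (source h chi x (snd (u s))))) \<and>
        (\<forall>t. snd (v t) = snd (u 0) + oriented_integral t (\<lambda>s. coad (snd (u s)) (spin_field chi \<beta> x (fst (u s)))))"
      unfolding weak_solution_def A[symmetric] B[symmetric] using True by blast
    then show ?thesis
      using cv unfolding rhs by (auto simp: prod_eq_iff)
  next
    case False
    then show ?thesis by (simp add: weak_solution_def cont)
  qed
qed

text \<open>Conservation of the spin norm makes the field component of the integrand bounded by a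
  constant, and integration gives linear growth. The integrand \<open>g\<close> and the element
  \<open>A\<close> are left abstract so that the bounds hold both with and without
  truncation.\<close>

lemma a_priori_bounds:
  fixes v :: "real \<Rightarrow> 'n::finite state"
  assumes g: "continuous_on UNIV g" and v: "\<And>t. v t = v0 + oriented_integral t g"
    and fst_g: "\<And>t. norm (fst (g t)) \<le> C * norm (snd (v t))"
    and snd_g: "\<And>t. snd (g t) = coad (snd (v t)) (A t)"
  shows "norm (snd (v t)) = norm (snd v0)"
    and "norm (fst (v t)) \<le> norm (fst v0) + C * \<bar>t\<bar> * norm (snd v0)"
proof -
  have v0: "v 0 = v0" by (subst v) simp
  have "(v has_vector_derivative g t) (at t)" for t
    unfolding v[abs_def]
    by (auto intro!: derivative_eq_intros has_vector_derivative_oriented_integral g)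
  then have "((\<lambda>t. snd (v t)) has_vector_derivative coad (snd (v t)) (A t)) (at t)" for t
    unfolding snd_g[symmetric] by (rule bounded_linear.has_vector_derivative[OF bounded_linear_snd])
  from coad_norm_conserved[of "\<lambda>t. snd (v t)", OF this]
  have conserved: "norm (snd (v t)) = norm (snd v0)" for t
    by (simp add: v0)
  then show "norm (snd (v t)) = norm (snd v0)" .
  have "norm (oriented_integral t (\<lambda>s. fst (g s))) \<le> (C * norm (snd v0)) * \<bar>t\<bar> ^ Suc 0 / real (Suc 0)"
    using fst_g by (intro norm_oriented_integral_le continuous_intros g) (simp add: conserved)
  moreover have "fst (v t) = fst v0 + oriented_integral t (\<lambda>s. fst (g s))"
    by (subst v) (simp add: oriented_integral_linear[OF bounded_linear_fst g])
  ultimately show "norm (fst (v t)) \<le> norm (fst v0) + C * \<bar>t\<bar> * norm (snd v0)"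
    using norm_triangle_ineq[of "fst v0" "oriented_integral t (\<lambda>s. fst (g s))"] by (simp add: mult_ac)
qed

section \<open>The truncated equation and global well-posedness\<close>

definition truncated_rhs ::
  "real \<Rightarrow> (real \<Rightarrow> real) \<Rightarrow> real^3 \<Rightarrow> ('n::finite \<Rightarrow> real^3) \<Rightarrow> (real \<Rightarrow> real) \<Rightarrow> real \<Rightarrow>
     real \<Rightarrow> 'n state \<Rightarrow> 'n state" where
  "truncated_rhs h chi \<beta> x \<kappa> \<rho> t v = rhs h chi \<beta> x t (radial_retract (\<kappa> t) (fst v), radial_retract \<rho> (snd v))"

lemma continuous_on_truncated_rhs:
  assumes "continuous_on UNIV v" "continuous_on UNIV \<kappa>" "\<And>t. 0 < \<kappa> t" "0 < \<rho>"
  shows "continuous_on UNIV (\<lambda>t. truncated_rhs h chi \<beta> x \<kappa> \<rho> t (v t))"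
  unfolding truncated_rhs_def
  by (intro continuous_on_rhs continuous_intros continuous_on_radial_retract assms)

text \<open>The only nonlinearity is the product of the spin with an affine function of the field,
  which is Lipschitz on bounded sets. The retractions keep both factors bounded, at the price of a
  factor 2.\<close>

lemma truncated_rhs_lipschitz:
  assumes \<kappa>: "\<And>t. 0 < \<kappa> t" "\<And>t. \<bar>t\<bar> \<le> T \<Longrightarrow> \<kappa> t \<le> K" and \<rho>: "0 < \<rho>" and "0 \<le> K"
  shows "\<exists>L\<ge>0. \<forall>t u v. \<bar>t\<bar> \<le> T \<longrightarrow>
    norm (truncated_rhs h chi \<beta> x \<kappa> \<rho> t u - truncated_rhs h chi \<beta> x \<kappa> \<rho> t v) \<le> L * norm (u - v)"
proof -
  interpret coad: bounded_bilinear coad by (rule bounded_bilinear_coad)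
  let ?S = "source h chi x" and ?A = "spin_field chi \<beta> x"
  obtain C where C: "0 \<le> C" "\<And>\<omega>. norm (?S \<omega>) \<le> norm \<omega> * C"
    using bounded_linear.nonneg_bounded[OF bounded_linear_source, of h chi x] by blast
  obtain D where D: "0 \<le> D" "\<And>X. norm (spin_field chi 0 x X) \<le> norm X * D"
    using bounded_linear.nonneg_bounded[OF bounded_linear_spin_field_0, of chi x] by blast
  obtain E where E: "0 \<le> E" "\<And>\<omega> X. norm (coad \<omega> (X :: ('a \<Rightarrow> 2) su)) \<le> norm \<omega> * norm X * E"
    using coad.nonneg_bounded by blast
  \<comment> \<open>A bound for the spin field on the ball of radius \<open>K\<close>: its value at
    0 plus its linear part.\<close>
  define a where "a = norm (?A 0) + K * D"
  have a: "0 \<le> a" using \<open>0 \<le> K\<close> D by (simp add: a_def)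
  \<comment> \<open>The three summands come from the source term, from varying the spin, and from
    varying the spin field; each factor 2 is the Lipschitz constant of a retraction.\<close>
  define L where "L = 2 * C + (2 * a * E + \<rho> * (2 * D) * E)"
  show ?thesis
  proof (intro exI[of _ L] conjI allI impI)
    show "0 \<le> L" using a C D E \<rho> by (simp add: L_def)
    fix t and u v :: "'a state" assume t: "\<bar>t\<bar> \<le> T"
    define q1 q2 where "q1 = radial_retract (\<kappa> t) (fst u)" and "q2 = radial_retract (\<kappa> t) (fst v)"
    define w1 w2 where "w1 = radial_retract \<rho> (snd u)" and "w2 = radial_retract \<rho> (snd v)"
    have q: "norm (q1 - q2) \<le> 2 * norm (u - v)"
      using norm_radial_retract_diff_le[OF \<kappa>(1), of t "fst u" "fst v"] norm_fst_le[of "fst u - fst v" "snd u - snd v"]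
      by (simp add: minus_prod_def q1_def q2_def)
    have w: "norm (w1 - w2) \<le> 2 * norm (u - v)"
      using norm_radial_retract_diff_le[OF \<rho>, of "snd u" "snd v"] norm_snd_le[of "snd u - snd v" "fst u - fst v"]
      by (simp add: minus_prod_def w1_def w2_def)
    have w2: "norm w2 \<le> \<rho>" unfolding w2_def by (rule norm_radial_retract_le[OF \<rho>])
    have "norm q1 \<le> K"
      unfolding q1_def using norm_radial_retract_le(1)[OF \<kappa>(1), of t "fst u"] \<kappa>(2)[OF t] by linarith
    then have A1: "norm (?A (free_flow t q1)) \<le> a"
      using norm_triangle_ineq[of "?A 0" "spin_field chi 0 x (free_flow t q1)"] D(2)[of "free_flow t q1"]
        mult_right_mono[OF _ D(1), of "norm q1" K]
      by (subst spin_field_eq) (simp add: a_def)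
    have A12: "norm (?A (free_flow t q1) - ?A (free_flow t q2)) \<le> 2 * norm (u - v) * D"
      using D(2)[of "free_flow t (q1 - q2)"] mult_right_mono[OF q D(1)]
      by (simp add: spin_field_diff linear_diff[OF linear_free_flow, symmetric])
    have 1: "norm (free_flow (- t) (?S w1) - free_flow (- t) (?S w2)) \<le> 2 * norm (u - v) * C"
      using C(2)[of "w1 - w2"] mult_right_mono[OF w C(1)]
      by (simp add: linear_diff[OF linear_free_flow, symmetric]
          linear_diff[OF bounded_linear.linear[OF bounded_linear_source], symmetric])
    have "coad w1 (?A (free_flow t q1)) - coad w2 (?A (free_flow t q2))
        = coad (w1 - w2) (?A (free_flow t q1)) + coad w2 (?A (free_flow t q1) - ?A (free_flow t q2))"
      by (simp add: coad.diff_left coad.diff_right)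
    also have "norm \<dots> \<le> norm (w1 - w2) * norm (?A (free_flow t q1)) * E
        + norm w2 * norm (?A (free_flow t q1) - ?A (free_flow t q2)) * E"
      by (intro order_trans[OF norm_triangle_ineq] add_mono E)
    also have "\<dots> \<le> (2 * norm (u - v)) * a * E + \<rho> * (2 * norm (u - v) * D) * E"
      using a C D E \<rho> by (intro add_mono mult_right_mono mult_mono w A1 w2 A12) auto
    finally have 2: "norm (coad w1 (?A (free_flow t q1)) - coad w2 (?A (free_flow t q2)))
        \<le> (2 * norm (u - v)) * a * E + \<rho> * (2 * norm (u - v) * D) * E" .
    have "norm (truncated_rhs h chi \<beta> x \<kappa> \<rho> t u - truncated_rhs h chi \<beta> x \<kappa> \<rho> t v)
        \<le> norm (free_flow (- t) (?S w1) - free_flow (- t) (?S w2))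
          + norm (coad w1 (?A (free_flow t q1)) - coad w2 (?A (free_flow t q2)))"
      unfolding truncated_rhs_def rhs_def fst_conv snd_conv diff_Pair
        q1_def[symmetric] q2_def[symmetric] w1_def[symmetric] w2_def[symmetric]
      by (rule norm_Pair_le)
    also have "\<dots> \<le> L * norm (u - v)"
      using 1 2 by (simp add: L_def algebra_simps)
    finally show "norm (truncated_rhs h chi \<beta> x \<kappa> \<rho> t u - truncated_rhs h chi \<beta> x \<kappa> \<rho> t v) \<le> L * norm (u - v)" .
  qed
qed

text \<open>Supplies the constant of the growth estimate. It does not depend on time because the
  flow is isometric.\<close>

lemma source_bound:
  "\<exists>C\<ge>0. \<forall>t \<omega>. norm (free_flow t (source h chi x \<omega>)) \<le> C * norm \<omega>"
  using bounded_linear.nonneg_bounded[OF bounded_linear_source, of h chi x]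
  by (simp add: mult.commute)

lemma rhs_a_priori_bounds:
  fixes v :: "real \<Rightarrow> 'n::finite state"
  assumes C: "\<forall>t \<omega>. norm (free_flow t (source h chi x \<omega>)) \<le> C * norm \<omega>"
    and v: "continuous_on UNIV v" "\<forall>t. v t = v0 + oriented_integral t (\<lambda>s. rhs h chi \<beta> x s (v s))"
  shows "norm (snd (v t)) = norm (snd v0)"
    and "norm (fst (v t)) \<le> norm (fst v0) + C * \<bar>t\<bar> * norm (snd v0)"
proof -
  have 1: "norm (fst (rhs h chi \<beta> x t (v t))) \<le> C * norm (snd (v t))" for t
    using C by (simp add: rhs_def)
  have 2: "snd (rhs h chi \<beta> x t (v t)) = coad (snd (v t)) (spin_field chi \<beta> x (free_flow t (fst (v t))))" for t
    by (simp add: rhs_def)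
  show "norm (snd (v t)) = norm (snd v0)"
    "norm (fst (v t)) \<le> norm (fst v0) + C * \<bar>t\<bar> * norm (snd v0)"
    using a_priori_bounds[OF continuous_on_rhs[OF v(1)] v(2)[rule_format] 1 2] by blast+
qed

text \<open>The original and the truncated equation have the same solutions: every solution of
  either one obeys the a priori bounds and so stays in the balls on which the retractions are the
  identity. Existence and uniqueness are then inherited from the globally Lipschitz truncated
  equation.\<close>

lemma interaction_unique_solution:
  fixes v0 :: "'n::finite state"
  shows "\<exists>!v. continuous_on UNIV v \<and> (\<forall>t. v t = v0 + oriented_integral t (\<lambda>s. rhs h chi \<beta> x s (v s)))"
    (is "\<exists>!v. ?sol v")
proof -
  obtain C where C: "0 \<le> C" "\<forall>t \<omega>. norm (free_flow t (source h chi x \<omega>)) \<le> C * norm \<omega>"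
    using source_bound[of h chi x] by blast
  \<comment> \<open>The radii are the a priori bounds increased by 1, which keeps them positive even
    for zero initial data.\<close>
  define \<kappa> where "\<kappa> t = 1 + norm (fst v0) + C * \<bar>t\<bar> * norm (snd v0)" for t
  define \<rho> where "\<rho> = 1 + norm (snd v0)"
  have \<kappa>: "0 < \<kappa> t" for t using C by (simp add: \<kappa>_def add_pos_nonneg)
  have \<rho>: "0 < \<rho>" by (simp add: \<rho>_def add_pos_nonneg)
  have cont_\<kappa>: "continuous_on UNIV \<kappa>" unfolding \<kappa>_def by (intro continuous_intros)
  let ?F = "truncated_rhs h chi \<beta> x \<kappa> \<rho>"
  have lip: "\<exists>L\<ge>0. \<forall>t u v. \<bar>t\<bar> \<le> T \<longrightarrow> norm (?F t u - ?F t v) \<le> L * norm (u - v)" for T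
  proof (rule truncated_rhs_lipschitz)
    show "\<kappa> t \<le> \<kappa> T" if "\<bar>t\<bar> \<le> T" for t
      using that C by (auto simp: \<kappa>_def intro!: mult_right_mono mult_left_mono)
  qed (use \<kappa> \<rho> less_imp_le in auto)
  have cont: "continuous_on UNIV u \<Longrightarrow> continuous_on UNIV (\<lambda>t. ?F t (u t))" for u
    by (intro continuous_on_truncated_rhs cont_\<kappa> \<kappa> \<rho>)
  let ?sol' = "\<lambda>v. continuous_on UNIV v \<and> (\<forall>t. v t = v0 + oriented_integral t (\<lambda>s. ?F s (v s)))"
  have untruncate: "rhs h chi \<beta> x t (v t) = ?F t (v t)"
    if "norm (snd (v t)) = norm (snd v0)" "norm (fst (v t)) \<le> norm (fst v0) + C * \<bar>t\<bar> * norm (snd v0)"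
    for v t
    using that \<kappa> \<rho> by (simp add: truncated_rhs_def radial_retract_id \<kappa>_def \<rho>_def)
  have sol: "?sol v \<longleftrightarrow> ?sol' v" for v
  proof
    assume v: "?sol v"
    have "rhs h chi \<beta> x t (v t) = ?F t (v t)" for t
      using v by (intro untruncate rhs_a_priori_bounds[OF C(2)]) blast+
    then have eq: "(\<lambda>t. rhs h chi \<beta> x t (v t)) = (\<lambda>t. ?F t (v t))" by (rule ext)
    from v show "?sol' v" unfolding eq .
  next
    assume v: "?sol' v"
    \<comment> \<open>Truncation multiplies the spin by a scalar. By bilinearity of
      \<open>coad\<close> this scalar is moved to the Lie algebra argument, so the truncated spin
      equation is still a coadjoint motion of the untruncated spin.\<close>
    define B where "B t = (\<rho> / max \<rho> (norm (snd (v t)))) *\<^sub>R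
        spin_field chi \<beta> x (free_flow t (radial_retract (\<kappa> t) (fst (v t))))" for t
    \<comment> \<open>The retraction does not increase the norm, so the source bound survives
      truncation with the same constant \<open>C\<close>.\<close>
    have fst_F: "norm (fst (?F t (v t))) \<le> C * norm (snd (v t))" for t
      using order_trans[OF C(2)[rule_format] mult_left_mono[OF norm_radial_retract_le(2)[OF \<rho>] C(1)]]
      by (simp add: truncated_rhs_def rhs_def)
    have snd_F: "snd (?F t (v t)) = coad (snd (v t)) (B t)" for t
      by (simp add: truncated_rhs_def rhs_def B_def bounded_bilinear.scaleR_right[OF bounded_bilinear_coad]
          bounded_bilinear.scaleR_left[OF bounded_bilinear_coad] radial_retract_def[of \<rho>])
    have "norm (snd (v t)) = norm (snd v0)"
      "norm (fst (v t)) \<le> norm (fst v0) + C * \<bar>t\<bar> * norm (snd v0)" for t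
      using a_priori_bounds[OF cont[OF conjunct1[OF v]] conjunct2[OF v, rule_format] fst_F snd_F] by blast+
    then have "rhs h chi \<beta> x t (v t) = ?F t (v t)" for t
      by (rule untruncate)
    then have eq: "(\<lambda>t. rhs h chi \<beta> x t (v t)) = (\<lambda>t. ?F t (v t))" by (rule ext)
    from v show "?sol v" unfolding eq .
  qed
  have "\<exists>v. ?sol' v" by (rule picard_exists[OF lip cont])
  moreover have "v = w" if "?sol' v" "?sol' w" for v w
    using that by (intro picard_unique[OF lip cont]) blast+
  ultimately show ?thesis unfolding sol by blast
qed

section \<open>Weak solutions\<close>

lemma weak_solution_unique_existence:
  "\<exists>!u. weak_solution h chi \<beta> x u \<and> u 0 = v0"
proof -
  obtain v where v: "continuous_on UNIV v" "\<And>t. v t = v0 + oriented_integral t (\<lambda>s. rhs h chi \<beta> x s (v s))"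
    and unique: "\<And>w. continuous_on UNIV w \<Longrightarrow>
      (\<And>t. w t = v0 + oriented_integral t (\<lambda>s. rhs h chi \<beta> x s (w s))) \<Longrightarrow> w = v"
    using interaction_unique_solution[of v0 h chi \<beta> x] by blast
  have v0: "v 0 = v0" by (subst v(2)) simp
  then have init: "from_interaction v 0 = v0" by (simp add: from_interaction_def)
  show ?thesis
  proof (rule ex1I[of _ "from_interaction v"])
    show "weak_solution h chi \<beta> x (from_interaction v) \<and> from_interaction v 0 = v0"
      unfolding weak_solution_iff_interaction to_from_interaction init
      by (intro conjI allI refl v)
  next
    fix u assume u: "weak_solution h chi \<beta> x u \<and> u 0 = v0"
    then have u0: "u 0 = v0" ..
    from u have "weak_solution h chi \<beta> x u" ..
    then have "continuous_on UNIV (to_interaction u)"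
      "\<forall>t. to_interaction u t = v0 + oriented_integral t (\<lambda>s. rhs h chi \<beta> x s (to_interaction u s))"
      unfolding weak_solution_iff_interaction u0 by (rule conjunct1, rule conjunct2)
    then have "to_interaction u = v" by (intro unique) blast+
    then show "u = from_interaction v" using from_to_interaction by metis
  qed
qed

lemma weak_solution_bounds:
  "\<exists>C. \<forall>u. weak_solution h chi \<beta> x u \<longrightarrow>
     (\<forall>t. norm (snd (u t)) = norm (snd (u 0)) \<and>
          norm (fst (u t)) \<le> norm (fst (u 0)) + C * \<bar>t\<bar> * norm (snd (u 0)))"
proof -
  obtain C where C: "0 \<le> C" "\<forall>t \<omega>. norm (free_flow t (source h chi x \<omega>)) \<le> C * norm \<omega>"
    using source_bound[of h chi x] by blast
  show ?thesis
  proof (intro exI[of _ C] allI impI)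
    fix u t assume "weak_solution h chi \<beta> x u"
    then have u: "continuous_on UNIV (to_interaction u)"
      "\<forall>t. to_interaction u t = u 0 + oriented_integral t (\<lambda>s. rhs h chi \<beta> x s (to_interaction u s))"
      unfolding weak_solution_iff_interaction by (rule conjunct1, rule conjunct2)
    have "norm (snd (to_interaction u t)) = norm (snd (u 0))"
      "norm (fst (to_interaction u t)) \<le> norm (fst (u 0)) + C * \<bar>t\<bar> * norm (snd (u 0))"
      by (rule rhs_a_priori_bounds[OF C(2) u])+
    then show "norm (snd (u t)) = norm (snd (u 0)) \<and>
        norm (fst (u t)) \<le> norm (fst (u 0)) + C * \<bar>t\<bar> * norm (snd (u 0))"
      by (simp add: to_interaction_def)
  qed
qed

subsection \<open>Regularity\<close>

lemma higher_deriv_times_id: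
  fixes f :: "real \<Rightarrow> real"
  assumes f: "\<And>n r. (deriv ^^ n) f differentiable (at r)"
  shows "(deriv ^^ n) (\<lambda>r. r * f r) = (\<lambda>r. r * (deriv ^^ n) f r + of_nat n * (deriv ^^ (n - 1)) f r)"
proof (induction n)
  case (Suc n)
  have D: "((deriv ^^ n) f has_real_derivative (deriv ^^ Suc n) f r) (at r)" for n r
    using f[of n r] by (simp add: DERIV_deriv_iff_real_differentiable)
  \<comment> \<open>For n = 0 the truncated subtraction gives n - 1 = 0, which is harmless because
    the factor \<open>of_nat n\<close> vanishes.\<close>
  have "((\<lambda>r. of_nat n * (deriv ^^ (n - 1)) f r) has_real_derivative of_nat n * (deriv ^^ n) f r) (at r)" for r
    using DERIV_cmult[OF D[of "n - 1"]] by (cases "n = 0") simp_all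
  from DERIV_add[OF DERIV_mult[OF DERIV_ident D] this]
  have "((\<lambda>r. r * (deriv ^^ n) f r + of_nat n * (deriv ^^ (n - 1)) f r) has_real_derivative
      r * (deriv ^^ Suc n) f r + of_nat (Suc n) * (deriv ^^ n) f r) (at r)" for r
    by (rule DERIV_cong) (simp add: algebra_simps)
  then show ?case
    by (auto simp: Suc.IH intro!: DERIV_imp_deriv)
qed simp

lemma schwartz_times_id:
  assumes "schwartz f"
  shows "schwartz (\<lambda>r. r * f r)"
proof -
  have diff: "(deriv ^^ n) f differentiable (at r)" for n r
    using assms by (simp add: schwartz_def)
  have bdd: "bounded (range (\<lambda>r. r ^ m * (deriv ^^ n) f r))" for m n
    using assms by (simp add: schwartz_def)
  note eq = higher_deriv_times_id[OF diff]
  show ?thesis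
    unfolding schwartz_def
  proof (intro conjI allI)
    show "(deriv ^^ n) (\<lambda>r. r * f r) differentiable (at r)" for n r
      unfolding eq by (intro derivative_intros diff)
    have "bounded (range (\<lambda>r. r ^ Suc m * (deriv ^^ n) f r + of_nat n * (r ^ m * (deriv ^^ (n - 1)) f r)))" for m n
      using bounded_scaleR_comp[OF bdd, of "of_nat n" m "n - 1"]
      by (intro bounded_plus_comp bdd) simp
    then show "bounded (range (\<lambda>r. r ^ m * (deriv ^^ n) (\<lambda>r. r * f r) r))" for m n
      unfolding eq by (simp add: algebra_simps)
  qed
qed

lemma schwartz_add:
  assumes "schwartz f" "schwartz g"
  shows "schwartz (\<lambda>r. f r + g r)"
proof -
  have diff: "(deriv ^^ n) f differentiable (at r)" "(deriv ^^ n) g differentiable (at r)" for n r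
    using assms by (simp_all add: schwartz_def)
  have bdd: "bounded (range (\<lambda>r. r ^ m * (deriv ^^ n) f r))" "bounded (range (\<lambda>r. r ^ m * (deriv ^^ n) g r))" for m n
    using assms by (simp_all add: schwartz_def)
  have eq: "(deriv ^^ n) (\<lambda>r. f r + g r) = (\<lambda>r. (deriv ^^ n) f r + (deriv ^^ n) g r)" for n
  proof (induction n)
    case (Suc n)
    show ?case
      using diff[of n]
      by (auto simp: Suc.IH DERIV_deriv_iff_real_differentiable[symmetric] intro!: DERIV_imp_deriv derivative_intros)
  qed simp
  show ?thesis
    unfolding schwartz_def eq distrib_left
    by (intro conjI allI bounded_plus_comp bdd derivative_intros diff)
qed

text \<open>The cut-off (1 + r) chi(r), expanded so that the closure of the Schwartz class under
  sums and under multiplication by r applies directly.\<close>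

abbreviation lifted_cutoff :: "(real \<Rightarrow> real) \<Rightarrow> real \<Rightarrow> real" where
  "lifted_cutoff chi \<equiv> \<lambda>r. chi r + r * chi r"

lemma resolvent_abs_hfield:
  "transverse_L2 f \<Longrightarrow> resolvent (abs_hfield f) = abs_hfield (\<lambda>k. (1 / (1 + norm k)) *\<^sub>R f k)"
  unfolding resolvent_def by (simp add: mult_op.abs_eq hrel_def)

text \<open>The factor 1 + |k| of the lifted cut-off cancels the symbol of the resolvent. As the
  lifted cut-off is again Schwartz, its coupling functions represent vectors of H, and the original
  coupling vectors therefore lie in the domain of M.\<close>

lemma resolvent_coupling_vectors:
  assumes "schwartz chi"
  shows "resolvent (a_vec (lifted_cutoff chi) m y) = a_vec chi m y"
    and "resolvent (b_vec (lifted_cutoff chi) m y) = b_vec chi m y"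
proof -
  have s: "schwartz (lifted_cutoff chi)"
    by (intro schwartz_add schwartz_times_id assms)
  have c: "(1 / (1 + r)) * ((chi r + r * chi r) * a / b * d) = chi r * a / b * d" if "0 \<le> r" for r a b d :: real
  proof -
    have "chi r + r * chi r = (1 + r) * chi r" by (simp add: algebra_simps)
    then show ?thesis using that by simp
  qed
  have "(1 / (1 + norm k)) *\<^sub>R a_fun (lifted_cutoff chi) m y k = a_fun chi m y k"
    "(1 / (1 + norm k)) *\<^sub>R b_fun (lifted_cutoff chi) m y k = b_fun chi m y k" for k
    unfolding a_fun_def b_fun_def by (subst scaleR_scaleR, simp only: c norm_ge_zero)+
  then show "resolvent (a_vec (lifted_cutoff chi) m y) = a_vec chi m y"
    "resolvent (b_vec (lifted_cutoff chi) m y) = b_vec chi m y"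
    unfolding a_vec_def b_vec_def resolvent_abs_hfield[OF transverse_L2_a_fun[OF s]]
      resolvent_abs_hfield[OF transverse_L2_b_fun[OF s]] by simp_all
qed

section \<open>From weak to strong solutions\<close>

definition resolvent2 :: "hfield \<times> hfield \<Rightarrow> hfield \<times> hfield" where
  "resolvent2 X = (resolvent (fst X), resolvent (snd X))"

lemma bounded_linear_resolvent: "bounded_linear resolvent"
  unfolding resolvent_def by (rule bounded_linear_mult_op)

lemma bounded_linear_M_resolvent: "bounded_linear M_resolvent"
  unfolding M_resolvent_def by (rule bounded_linear_mult_op)

lemma bounded_linear_resolvent2: "bounded_linear resolvent2"
  unfolding resolvent2_def[abs_def]
  by (intro bounded_linear_Pair bounded_linear_compose[OF bounded_linear_resolvent]
      bounded_linear_fst bounded_linear_snd)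

lemma free_flow_resolvent2: "free_flow t (resolvent2 X) = resolvent2 (free_flow t X)"
  unfolding free_flow_eq resolvent2_def fst_conv snd_conv resolvent_def
  by (simp add: mult_op_commute[of _ "\<lambda>k. 1 / (1 + norm k)"] linear_add[OF linear_mult_op] linear_diff[OF linear_mult_op])

text \<open>Multipliers commute, so the generator can be moved past the flow. The derivative is
  thereby expressed through M at the transported vector, the form in which it enters the
  differential equations.\<close>

lemma free_flow_resolvent2_derivative:
  "((\<lambda>s. free_flow s (resolvent2 Z)) has_vector_derivative
     (M_resolvent (snd (free_flow t Z)), - M_resolvent (fst (free_flow t Z)))) (at t)"
proof -
  have "(M_resolvent (snd (free_flow t Z)), - M_resolvent (fst (free_flow t Z)))
      = free_flow t (M_resolvent (snd Z), - M_resolvent (fst Z))"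
    unfolding free_flow_eq fst_conv snd_conv M_resolvent_def
    by (simp add: mult_op_commute[of _ "\<lambda>k. norm k / (1 + norm k)"] linear_add[OF linear_mult_op]
        linear_diff[OF linear_mult_op] linear_neg[OF linear_mult_op])
  then show ?thesis
    unfolding resolvent2_def by (simp add: free_flow_has_vector_derivative)
qed

lemma source_resolvent2:
  assumes "schwartz chi"
  shows "source h chi x \<omega> = resolvent2 (source h (lifted_cutoff chi) x \<omega>)"
  unfolding source_def resolvent2_def source_q_def source_p_def fst_conv snd_conv
  using bounded_linear.linear[OF bounded_linear_resolvent]
  by (simp only: linear_neg linear_scale linear_sum resolvent_coupling_vectors[OF assms])

text \<open>In the interaction picture the field is \<open>resolvent2\<close> of a curve
  \<open>Z\<close> that is itself an integral in H. No unbounded operator has to be exchanged with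
  an integral, only the bounded resolvent.\<close>

lemma weak_solution_strong:
  fixes u :: "real \<Rightarrow> 'n::finite state"
  assumes chi: "schwartz chi" and u: "weak_solution h chi \<beta> x u"
    and dom: "fst (fst (u 0)) \<in> DM" "snd (fst (u 0)) \<in> DM"
  shows "strong_solution h chi \<beta> x u"
proof -
  define v where "v = to_interaction u"
  define \<omega> where "\<omega> t = snd (u t)" for t
  \<comment> \<open>The interaction-picture source with 1 + M applied to it, obtained by lifting the
    cut-off.\<close>
  define S' where "S' t = free_flow (- t) (source h (lifted_cutoff chi) x (\<omega> t))" for t
  have cv: "continuous_on UNIV v"
    and v: "\<forall>t. v t = u 0 + oriented_integral t (\<lambda>s. rhs h chi \<beta> x s (v s))"
    using u unfolding weak_solution_iff_interaction v_def by (rule conjunct1, rule conjunct2)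
  have cu: "continuous_on UNIV u" using u by (simp add: weak_solution_def)
  have uv: "fst (u t) = free_flow t (fst (v t))" "snd (v t) = \<omega> t" for t
    by (simp_all add: v_def \<omega>_def to_interaction_def free_flow_add)
  have c\<omega>: "continuous_on UNIV \<omega>" unfolding \<omega>_def by (intro continuous_intros cu)
  have cS': "continuous_on UNIV S'"
    unfolding S'_def
    by (intro continuous_intros bounded_linear.continuous_on[OF bounded_linear_source] c\<omega>)
  obtain G where G: "fst (u 0) = resolvent2 G"
  proof -
    obtain f g where "fst (fst (u 0)) = resolvent f" "snd (fst (u 0)) = resolvent g"
      using dom by (elim DM_resolvent)
    then show thesis by (intro that[of "(f, g)"]) (simp add: resolvent2_def prod_eq_iff)
  qed
  \<comment> \<open>The candidate for (1 + M) applied to the interaction-picture field;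
    \<open>G\<close> is (1 + M) applied to the initial field.\<close>
  define Z where "Z t = G + oriented_integral t S'" for t
  have dZ: "(Z has_vector_derivative S' t) (at t)" for t
    unfolding Z_def[abs_def]
    by (auto intro!: derivative_eq_intros has_vector_derivative_oriented_integral cS')
  have cZ: "continuous_on UNIV Z"
    unfolding Z_def[abs_def] by (intro continuous_intros continuous_on_oriented_integral cS')
  have S': "resolvent2 (S' t) = free_flow (- t) (source h chi x (\<omega> t))" for t
    unfolding S'_def by (simp add: free_flow_resolvent2[symmetric] source_resolvent2[OF chi])
  have Z: "fst (v t) = resolvent2 (Z t)" for t
  proof -
    have "fst (v t) = fst (u 0) + oriented_integral t (\<lambda>s. fst (rhs h chi \<beta> x s (v s)))"
      using oriented_integral_linear[OF bounded_linear_fst continuous_on_rhs[OF cv], of t h chi \<beta> x]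
        arg_cong[OF v[rule_format, of t], of fst] by simp
    also have "(\<lambda>s. fst (rhs h chi \<beta> x s (v s))) = (\<lambda>s. resolvent2 (S' s))"
      by (simp add: rhs_def S' uv)
    also have "fst (u 0) + oriented_integral t (\<lambda>s. resolvent2 (S' s)) = resolvent2 (Z t)"
      unfolding Z_def G
      by (simp add: oriented_integral_linear[OF bounded_linear_resolvent2 cS']
          linear_add[OF bounded_linear.linear[OF bounded_linear_resolvent2]])
    finally show ?thesis .
  qed
  define X where "X t = free_flow t (Z t)" for t
  have cX: "continuous_on UNIV X" unfolding X_def by (intro continuous_intros cZ)
  have u_eq: "u t = (resolvent2 (X t), \<omega> t)" for t
    by (simp add: prod_eq_iff uv Z X_def free_flow_resolvent2 \<omega>_def)
  \<comment> \<open>The free part (M p, - M q) of the equations, written with bounded operators. Its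
    continuity yields continuity of q and p in the graph norm.\<close>
  define MX where "MX t = (M_resolvent (snd (X t)), - M_resolvent (fst (X t)))" for t
  have cMX: "continuous_on UNIV (\<lambda>t. M_resolvent (fst (X t)))" "continuous_on UNIV (\<lambda>t. M_resolvent (snd (X t)))"
    by (intro continuous_intros cX bounded_linear.continuous_on[OF bounded_linear_M_resolvent])+
  have M: "M_op (fst (fst (u t))) = M_resolvent (fst (X t))" "M_op (snd (fst (u t))) = M_resolvent (snd (X t))" for t
    by (simp_all add: u_eq resolvent2_def M_op_resolvent)
  have dX: "((\<lambda>t. fst (u t)) has_vector_derivative MX t + source h chi x (\<omega> t)) (at t)" for t
  proof -
    have "((\<lambda>s. free_flow s (resolvent2 (Z s))) has_vector_derivative
        MX t + free_flow t (resolvent2 (S' t))) (at t)"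
      unfolding MX_def X_def
      by (intro free_flow_product_derivative free_flow_resolvent2_derivative
          bounded_linear.has_vector_derivative[OF bounded_linear_resolvent2] dZ)
    then show ?thesis by (simp add: uv Z S' free_flow_add)
  qed
  define \<omega>' where "\<omega>' t = coad (\<omega> t) (spin_field chi \<beta> x (fst (u t)))" for t
  have d\<omega>: "(\<omega> has_vector_derivative \<omega>' t) (at t)" for t
  proof -
    have "((\<lambda>t. u 0 + oriented_integral t (\<lambda>s. rhs h chi \<beta> x s (v s))) has_vector_derivative rhs h chi \<beta> x t (v t)) (at t)"
      by (auto intro!: derivative_eq_intros has_vector_derivative_oriented_integral continuous_on_rhs cv)
    then have "(v has_vector_derivative rhs h chi \<beta> x t (v t)) (at t)"
      by (simp only: v[rule_format, symmetric])
    from bounded_linear.has_vector_derivative[OF bounded_linear_snd this]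
    show ?thesis by (simp add: uv rhs_def \<omega>'_def)
  qed
  have du: "(u has_vector_derivative (MX t + source h chi x (\<omega> t), \<omega>' t)) (at t)" for t
    using has_vector_derivative_Pair[OF dX d\<omega>, of t] by (simp add: \<omega>_def)
  have cdu: "continuous_on UNIV (\<lambda>t. (MX t + source h chi x (\<omega> t), \<omega>' t))"
    unfolding MX_def \<omega>'_def
    by (intro continuous_intros cMX c\<omega> cu bounded_linear.continuous_on[OF bounded_linear_source]
      bounded_bilinear.continuous_on[OF bounded_bilinear_coad] continuous_on_spin_field)
  have C1: "u C1_differentiable_on UNIV"
    unfolding C1_differentiable_on_def
    by (rule exI[of _ "\<lambda>t. (MX t + source h chi x (\<omega> t), \<omega>' t)"]) (intro conjI ballI du cdu)
  have dq: "((\<lambda>t. fst (fst (u t))) has_vector_derivative M_op (snd (fst (u t))) + source_q h chi x (snd (u t))) (at t)"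
    and dp: "((\<lambda>t. snd (fst (u t))) has_vector_derivative - M_op (fst (fst (u t))) + source_p h chi x (snd (u t))) (at t)" for t
    using bounded_linear.has_vector_derivative[OF bounded_linear_fst dX, of t]
      bounded_linear.has_vector_derivative[OF bounded_linear_snd dX, of t]
    unfolding M by (simp_all add: MX_def source_def \<omega>_def)
  have dY: "((\<lambda>s. blinfun_apply (snd (u s)) Y) has_real_derivative
      (\<Sum>l\<in>UNIV. \<Sum>m\<in>UNIV. spin_term chi \<beta> x (u t) Y l m)) (at t)" for Y t
    unfolding has_real_derivative_iff_has_vector_derivative coad_spin_field_apply[symmetric]
    by (rule bounded_linear.has_vector_derivative[OF blinfun.bounded_linear_left
          d\<omega>[unfolded \<omega>'_def \<omega>_def[abs_def]]])
  have DM: "fst (fst (u t)) \<in> DM" "snd (fst (u t)) \<in> DM" for t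
    by (simp_all add: u_eq resolvent2_def resolvent_in_DM)
  show ?thesis
    unfolding strong_solution_def Let_def M[abs_def]
    by (intro conjI allI DM cu cMX C1 dq[unfolded M] dp[unfolded M] dY)
qed

theorem theorem2p1:
  fixes h :: real and chi :: "real \<Rightarrow> real" and \<beta> :: "real^3"
    and x :: "'n::finite \<Rightarrow> real^3"
  assumes "h > 0"
    and "schwartz chi"
    and "eventually (\<lambda>r. chi r = 0) (nhds 0)"
  shows "(\<forall>q0 p0 \<omega>0. \<exists>!u. weak_solution h chi \<beta> x u \<and> u 0 = ((q0, p0), \<omega>0)) \<and>
    (\<exists>C. \<forall>u. weak_solution h chi \<beta> x u \<longrightarrow>
       (\<forall>t. norm (snd (u t)) = norm (snd (u 0)) \<and>
            norm (fst (u t)) \<le> norm (fst (u 0)) + C * \<bar>t\<bar> * norm (snd (u 0)))) \<and>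
    (\<forall>u. weak_solution h chi \<beta> x u \<and> fst (fst (u 0)) \<in> DM \<and> snd (fst (u 0)) \<in> DM \<longrightarrow>
       strong_solution h chi \<beta> x u)"
  by (intro conjI allI impI weak_solution_unique_existence weak_solution_bounds)
     (elim conjE, rule weak_solution_strong[OF assms(2)])

end
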